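(* There is a restricted Lie algebra structure on the Virasoro algebra $\mathcal{V}ir$ over $\mathbb{F}$, whose $p$-mapping is uniquely determined by $\mathbf c^{[p]}=\mathbf c$ and, for $m\in\mathbb{Z}$, $$L_m^{[p]}=\begin{cases}L_{pm}&\text{if }p\mid m,\\0&\text{if }p\nmid m.\end{cases}$$
   Context: $\mathbb{F}$ is an algebraically closed field of prime characteristic $p\ge3$. $\mathcal{V}ir$ is the Lie algebra over $\mathbb{F}$ with basis $\{L_n\mid n\in\mathbb{Z}\}\cup\{\mathbf c\}$, where $\mathbf c$ is central and $[L_m,L_n]=(m-n)L_{m+n}+\frac12\binom{m+1}{3}\delta_{m+n,0}\mathbf c$ for $m,n\in\mathbb{Z}$ (integers, including the integer $\binom{m+1}{3}=(m+1)m(m-1)/6$, are viewed in $\mathbb{F}$). A restricted Lie algebra is a Lie algebra $\mathfrak g$ over $\mathbb{F}$ with a map $a\mapsto a^{[p]}$ (the $p$-mapping) such that (i) $\mathrm{ad}\,a^{[p]}=(\mathrm{ad}\,a)^p$; (ii) $(\lambda a)^{[p]}=\lambda^pa^{[p]}$ for $\lambda\in\mathbb{F}$; (iii) $(a+b)^{[p]}=a^{[p]}+b^{[p]}+\sum_{i=1}^{p-1}s_i(a,b)$, where $(\mathrm{ad}(a\otimes X+b\otimes1))^{p-1}(a\otimes1)=\sum_{i=1}^{p-1}i\,s_i(a,b)\otimes X^{i-1}$ in $\mathfrak g\otimes\mathbb{F}[X]$. *)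

theory Defs
  imports
    "HOL-Computational_Algebra.Primes"
    "HOL-Computational_Algebra.Polynomial"
    "HOL-Library.Poly_Mapping"
begin

section \<open>Lie algebras\<close>

locale lie_algebra = vector_space scale
  for scale :: "'f::field \<Rightarrow> 'g::ab_group_add \<Rightarrow> 'g" (infixr "*s" 75) +
  fixes bracket :: "'g \<Rightarrow> 'g \<Rightarrow> 'g"
  assumes bracket_linear_right: "Vector_Spaces.linear scale scale (\<lambda>y. bracket x y)"
    and bracket_linear_left: "Vector_Spaces.linear scale scale (\<lambda>x. bracket x y)"
    and bracket_self: "bracket x x = 0"
    and jacobi: "bracket x (bracket y z) + bracket y (bracket z x) + bracket z (bracket x y) = 0"

text \<open>
  The tensor product of \<open>\<gg>\<close> with the polynomial ring in \<open>X\<close> is represented by the type of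
  polynomials with coefficients in \<open>\<gg>\<close>, the tensor \<open>a \<otimes> X\<^sup>i\<close> being \<^term>\<open>monom a i\<close>.
  Its bracket is the bilinear extension of \<open>[a \<otimes> X\<^sup>i, b \<otimes> X\<^sup>j] = [a, b] \<otimes> X\<^sup>i\<^sup>+\<^sup>j\<close>.
\<close>

definition poly_bracket ::
    "('g::ab_group_add \<Rightarrow> 'g \<Rightarrow> 'g) \<Rightarrow> 'g poly \<Rightarrow> 'g poly \<Rightarrow> 'g poly" where
  "poly_bracket br P Q =
     (\<Sum>i\<le>Polynomial.degree P. \<Sum>j\<le>Polynomial.degree Q.
        monom (br (Polynomial.coeff P i) (Polynomial.coeff Q j)) (i + j))"

lemma poly_bracket_monom:
  assumes "\<And>x. br x 0 = 0" "\<And>x. br 0 x = 0"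
  shows "poly_bracket br (monom a i) (monom b j) = monom (br a b) (i + j)"
proof (cases "a = 0 \<or> b = 0")
  case True
  then show ?thesis using assms by (auto simp: poly_bracket_def)
next
  case False
  have "poly_bracket br (monom a i) (monom b j) =
      (\<Sum>i'\<le>i. \<Sum>j'\<le>j. if i' = i then if j' = j then monom (br a b) (i + j) else 0 else 0)"
    using False assms unfolding poly_bracket_def
    by (auto simp: degree_monom_eq intro!: sum.cong)
  also have "\<dots> = (\<Sum>i'\<le>i. if i' = i then monom (br a b) (i + j) else 0)"
    by (intro sum.cong) auto
  also have "\<dots> = monom (br a b) (i + j)" by simp
  finally show ?thesis .
qed

section \<open>Restricted Lie algebras\<close>

context lie_algebra
begin

text \<open>
  Defining equation of Jacobson's elements \<open>s\<^sub>i(a, b)\<close>, where \<open>p\<close> is the characteristic.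
  It determines \<open>s i\<close> for \<open>1 \<le> i < p\<close>; other values of \<open>s\<close> are irrelevant.
\<close>

definition jacobson_elements :: "'g \<Rightarrow> 'g \<Rightarrow> (nat \<Rightarrow> 'g) \<Rightarrow> bool" where
  "jacobson_elements a b s \<longleftrightarrow>
     (poly_bracket bracket (monom a 1 + monom b 0) ^^ (CHAR('f) - 1)) (monom a 0) =
     (\<Sum>i = 1..CHAR('f) - 1. monom (of_nat i *s s i) (i - 1))"

end

locale restricted_lie_algebra = lie_algebra scale bracket
  for scale :: "'f::field \<Rightarrow> 'g::ab_group_add \<Rightarrow> 'g" (infixr "*s" 75)
    and bracket :: "'g \<Rightarrow> 'g \<Rightarrow> 'g" +
  fixes pmap :: "'g \<Rightarrow> 'g"
  assumes prime_char: "prime CHAR('f)"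
    and ad_pmap: "bracket (pmap a) = bracket a ^^ CHAR('f)"
    and pmap_scale: "pmap (l *s a) = l ^ CHAR('f) *s pmap a"
    and pmap_add:
      "\<exists>s. jacobson_elements a b s \<and>
           pmap (a + b) = pmap a + pmap b + (\<Sum>i = 1..CHAR('f) - 1. s i)"

section \<open>The Virasoro algebra\<close>

datatype vir_index = L_index int | C_index

text \<open>The vector space with basis indexed by \<^typ>\<open>vir_index\<close>: finitely supported functions.\<close>

type_synonym 'f vir = "vir_index \<Rightarrow>\<^sub>0 'f"

definition vir_scale :: "'f::field \<Rightarrow> 'f vir \<Rightarrow> 'f vir" where
  "vir_scale l x = Poly_Mapping.map ((*) l) x"

definition vir_L :: "int \<Rightarrow> 'f::field vir" where
  "vir_L m = Poly_Mapping.single (L_index m) 1"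

definition vir_c :: "'f::field vir" where
  "vir_c = Poly_Mapping.single C_index 1"

text \<open>The integer \<open>(m + 1) m (m - 1) / 6\<close>, formed in \<^typ>\<open>int\<close> so that its image in the
  field makes sense in characteristic 3.\<close>

definition binom_Suc_3 :: "int \<Rightarrow> int" where
  "binom_Suc_3 m = (m + 1) * m * (m - 1) div 6"

fun vir_basis_bracket :: "vir_index \<Rightarrow> vir_index \<Rightarrow> 'f::field vir" where
  "vir_basis_bracket (L_index m) (L_index n) =
     vir_scale (of_int (m - n)) (vir_L (m + n)) +
     (if m + n = 0 then vir_scale (1 / 2 * of_int (binom_Suc_3 m)) vir_c else 0)"
| "vir_basis_bracket C_index _ = 0"
| "vir_basis_bracket _ C_index = 0"

definition vir_bracket :: "'f::field vir \<Rightarrow> 'f vir \<Rightarrow> 'f vir" where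
  "vir_bracket x y =
     (\<Sum>i\<in>Poly_Mapping.keys x. \<Sum>j\<in>Poly_Mapping.keys y.
        vir_scale (Poly_Mapping.lookup x i * Poly_Mapping.lookup y j) (vir_basis_bracket i j))"

lemma vir_scale_one [simp]: "vir_scale 1 x = x"
  by (rule poly_mapping_eqI) (simp add: vir_scale_def Poly_Mapping.map.rep_eq when_def)

lemma vir_bracket_L_L:
  "vir_bracket (vir_L m) (vir_L n) =
     vir_scale (of_int (m - n)) (vir_L (m + n)) +
     (if m + n = 0 then vir_scale (1 / 2 * of_int (binom_Suc_3 m)) vir_c else 0)"
  by (simp add: vir_bracket_def vir_L_def)

lemma vir_bracket_c: "vir_bracket vir_c x = 0" "vir_bracket x vir_c = 0"
proof -
  have z: "vir_scale l (0 :: 'a vir) = 0" for l :: 'a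
    by (rule poly_mapping_eqI) (simp add: vir_scale_def Poly_Mapping.map.rep_eq when_def)
  have "vir_basis_bracket i C_index = (0 :: 'a vir)" for i by (cases i) auto
  then show "vir_bracket vir_c x = 0" "vir_bracket x vir_c = 0"
    by (simp_all add: vir_bracket_def vir_c_def z)
qed

lemma binom_Suc_3: "6 * binom_Suc_3 m = (m + 1) * m * (m - 1)"
proof -
  have "2 dvd (m + 1) * m * (m - 1)" by simp
  moreover have "3 dvd (m + 1) * m * (m - 1)"
  proof -
    have "3 dvd m + 1 \<or> 3 dvd m \<or> 3 dvd m - 1" by presburger
    then show ?thesis by (auto intro: dvd_mult dvd_mult2)
  qed
  moreover have "6 dvd n" if "2 dvd n" "3 dvd n" for n :: int
    using that by presburger
  ultimately have "6 dvd (m + 1) * m * (m - 1)" by blast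
  then show ?thesis by (simp add: binom_Suc_3_def)
qed

end

theory Submission
  imports Defs
begin

text \<open>
  This is Jacobson's theorem: on a Lie algebra of characteristic \<open>p\<close> with a basis \<open>(e\<^sub>i)\<close> such that
  \<open>(ad e\<^sub>i)\<^sup>p = ad y\<^sub>i\<close>, there is a unique p-mapping with \<open>e\<^sub>i \<mapsto> y\<^sub>i\<close>. The enveloping algebra is avoided:
  \<open>s(a, b) = \<Sum>\<^sub>i s\<^sub>i(a, b)\<close> is a symmetric 2-cocycle, because the 1-form \<open>w \<mapsto> (ad w)\<^sup>p\<^sup>-\<^sup>1\<close> on the Lie
  algebra is closed; so \<open>(a, u) + (b, v) = (a + b, u + v + s(a, b))\<close> and
  \<open>l (a, u) = (l a, l\<^sup>p u)\<close> make \<open>\<gg> \<times> \<gg>\<close> a vector space, and p-mappings are the linear sections of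
  its projection to the first factor. Such a section may be prescribed on a basis.
  For the Virasoro algebra, \<open>(ad L\<^sub>m)\<^sup>p L\<^sub>n\<close> has coefficients containing the product of
  \<open>m - n - i m\<close> over \<open>i < p\<close> (or over \<open>i < p - 1\<close> for the central term). If \<open>p\<close> does not divide \<open>m\<close> this vanishes; otherwise
  Fermat's little theorem evaluates it.
\<close>

section \<open>Polynomials over a Lie algebra\<close>

text \<open>Reduces identities that are additive in each polynomial argument to monomials, by one
  induction per argument.\<close>

lemma additive_poly_induct:
  fixes x :: "'a::comm_monoid_add poly"
  assumes "\<And>a i. R (monom a i)" "\<And>x y. R x \<Longrightarrow> R y \<Longrightarrow> R (x + y)"
  shows "R x"
proof -
  have "R 0" using assms(1)[of 0 0] by simp
  moreover have "R (\<Sum>i\<in>A. monom (poly.coeff x i) i)" if "finite A" for A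
    using that calculation by (induction A rule: finite_induct) (simp_all add: assms)
  ultimately show ?thesis by (metis finite_atMost poly_as_sum_of_monoms)
qed

context lie_algebra
begin

lemma bracket_add_right: "bracket x (y + z) = bracket x y + bracket x z"
  and bracket_scale_right: "bracket x (l *s y) = l *s bracket x y"
  and bracket_zero_right [simp]: "bracket x 0 = 0"
  and bracket_sum_right: "bracket x (sum g A) = (\<Sum>i\<in>A. bracket x (g i))"
proof -
  interpret l: Vector_Spaces.linear scale scale "\<lambda>y. bracket x y" by (rule bracket_linear_right)
  show "bracket x (y + z) = bracket x y + bracket x z" by (rule l.add)
  show "bracket x (l *s y) = l *s bracket x y" by (rule l.scale)
  show "bracket x 0 = 0" by (rule l.zero)
  show "bracket x (sum g A) = (\<Sum>i\<in>A. bracket x (g i))" by (rule l.sum)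
qed

lemma bracket_add_left: "bracket (x + y) z = bracket x z + bracket y z"
  and bracket_scale_left: "bracket (l *s x) z = l *s bracket x z"
  and bracket_zero_left [simp]: "bracket 0 z = 0"
  and bracket_sum_left: "bracket (sum g A) z = (\<Sum>i\<in>A. bracket (g i) z)"
proof -
  interpret l: Vector_Spaces.linear scale scale "\<lambda>x. bracket x z" by (rule bracket_linear_left)
  show "bracket (x + y) z = bracket x z + bracket y z" by (rule l.add)
  show "bracket (l *s x) z = l *s bracket x z" by (rule l.scale)
  show "bracket 0 z = 0" by (rule l.zero)
  show "bracket (sum g A) z = (\<Sum>i\<in>A. bracket (g i) z)" by (rule l.sum)
qed

lemma bracket_antisym: "bracket x y = - bracket y x"
proof -
  have "bracket (x + y) (x + y) = bracket x y + bracket y x"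
    by (simp only: bracket_add_left bracket_add_right) (simp add: bracket_self)
  then show ?thesis by (simp add: bracket_self eq_neg_iff_add_eq_0)
qed

lemma bracket_uminus_right: "bracket x (- y) = - bracket x y"
  by (metis add_eq_0_iff bracket_add_right bracket_zero_right)

text \<open>The Jacobi identity read as: ad w is a derivation.\<close>

lemma bracket_bracket: "bracket w (bracket x y) = bracket (bracket w x) y + bracket x (bracket w y)"
proof -
  have "bracket w (bracket x y) + bracket x (bracket y w) + bracket y (bracket w x) = 0"
    by (rule jacobi)
  moreover have "bracket y (bracket w x) = - bracket (bracket w x) y" by (rule bracket_antisym)
  moreover have "bracket x (bracket y w) = - bracket x (bracket w y)"
    by (metis bracket_antisym bracket_uminus_right)
  ultimately show ?thesis by (simp add: algebra_simps)
qed

lemma of_nat_scale_add: "of_nat (m + n) *s x = of_nat m *s x + of_nat n *s x"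
  by (simp add: scale_left_distrib)

lemma bracket_pow_add: "(bracket w ^^ n) (x + y) = (bracket w ^^ n) x + (bracket w ^^ n) y"
  by (induction n) (simp_all add: bracket_add_right)

lemma bracket_pow_scale: "(bracket w ^^ n) (l *s x) = l *s (bracket w ^^ n) x"
  by (induction n) (simp_all add: bracket_scale_right)

lemma bracket_pow_zero [simp]: "(bracket w ^^ n) 0 = 0"
  by (induction n) simp_all

lemma bracket_pow_scale_left: "(bracket (l *s w) ^^ n) x = l ^ n *s (bracket w ^^ n) x"
  by (induction n) (simp_all add: bracket_scale_left bracket_scale_right)

lemma bracket_pow_eq_0:
  assumes "bracket w x = 0" "0 < n"
  shows "(bracket w ^^ n) x = 0"
  using assms by (cases n) (simp_all add: funpow_swap1)

section \<open>The Lie algebra g[X]\<close>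

abbreviation pscale :: "'f \<Rightarrow> 'g poly \<Rightarrow> 'g poly" where
  "pscale l \<equiv> map_poly (scale l)"

abbreviation pbracket :: "'g poly \<Rightarrow> 'g poly \<Rightarrow> 'g poly" where
  "pbracket \<equiv> poly_bracket bracket"

lemma coeff_pscale [simp]: "poly.coeff (pscale l P) n = l *s poly.coeff P n"
  by (simp add: coeff_map_poly)

lemma pscale_monom [simp]: "pscale l (monom a n) = monom (l *s a) n"
  by (simp add: map_poly_monom)

lemma vector_space_pscale: "vector_space pscale"
  by unfold_locales (auto intro!: poly_eqI simp: scale_right_distrib scale_left_distrib)

text \<open>Enlarging the summation ranges only adds zero terms. Sums of polynomials of different
  degrees can then be compared over one common range.\<close>

lemma pbracket_eq:
  assumes "degree P \<le> M" "degree Q \<le> N"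
  shows "pbracket P Q =
    (\<Sum>i\<le>M. \<Sum>j\<le>N. monom (bracket (poly.coeff P i) (poly.coeff Q j)) (i + j))"
proof -
  have "pbracket P Q =
      (\<Sum>i\<le>degree P. \<Sum>j\<le>N. monom (bracket (poly.coeff P i) (poly.coeff Q j)) (i + j))"
    unfolding poly_bracket_def using assms(2)
    by (intro sum.cong sum.mono_neutral_left) (auto simp: coeff_eq_0)
  also have "\<dots> = (\<Sum>i\<le>M. \<Sum>j\<le>N. monom (bracket (poly.coeff P i) (poly.coeff Q j)) (i + j))"
    using assms(1) by (intro sum.mono_neutral_left) (auto simp: coeff_eq_0)
  finally show ?thesis .
qed

lemma pbracket_add_right: "pbracket P (Q + R) = pbracket P Q + pbracket P R"
proof -
  define N where "N = max (degree (Q + R)) (max (degree Q) (degree R))"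
  have "degree (Q + R) \<le> N" "degree Q \<le> N" "degree R \<le> N" by (auto simp: N_def)
  then show ?thesis
    by (simp add: pbracket_eq[OF order_refl, of _ N] bracket_add_right add_monom[symmetric]
        sum.distrib)
qed

lemma pbracket_add_left: "pbracket (P + Q) R = pbracket P R + pbracket Q R"
proof -
  define N where "N = max (degree (P + Q)) (max (degree P) (degree Q))"
  have "degree (P + Q) \<le> N" "degree P \<le> N" "degree Q \<le> N" by (auto simp: N_def)
  then show ?thesis
    by (simp add: pbracket_eq[OF _ order_refl, of _ N] bracket_add_left add_monom[symmetric]
        sum.distrib)
qed

lemma pbracket_zero [simp]: "pbracket P 0 = 0" "pbracket 0 P = 0"
  by (simp_all add: poly_bracket_def)

lemma pbracket_monom [simp]: "pbracket (monom a i) (monom b j) = monom (bracket a b) (i + j)"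
  by (rule poly_bracket_monom) simp_all

lemma pscale_add: "pscale l (P + Q) = pscale l P + pscale l Q"
  by (rule poly_eqI) (simp add: scale_right_distrib)

lemma pbracket_scale_right: "pbracket P (pscale l Q) = pscale l (pbracket P Q)"
proof (induction P rule: additive_poly_induct)
  case (1 a i)
  show ?case
    by (induction Q rule: additive_poly_induct)
      (simp_all add: pbracket_add_right pscale_add bracket_scale_right)
qed (simp add: pbracket_add_left pscale_add)

lemma pbracket_antisym: "pbracket P Q = - pbracket Q P"
proof (induction P rule: additive_poly_induct)
  case (1 a i)
  show ?case
    by (induction Q rule: additive_poly_induct)
      (simp_all add: pbracket_add_right pbracket_add_left minus_monom add.commute
        bracket_antisym[symmetric])
qed (simp add: pbracket_add_left pbracket_add_right)

text \<open>Characteristic 2 is allowed here, so this cannot come from halving antisymmetry.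
  Monomials are checked directly, and for a sum the two cross terms cancel.\<close>

lemma pbracket_self: "pbracket P P = 0"
proof (induction P rule: additive_poly_induct)
  case (2 P Q)
  then show ?case
    using pbracket_antisym[of P Q] by (simp add: pbracket_add_left pbracket_add_right)
qed (simp add: bracket_self)

lemma pbracket_jacobi:
  "pbracket P (pbracket Q R) + pbracket Q (pbracket R P) + pbracket R (pbracket P Q) = 0"
proof -
  \<comment> \<open>The Jacobiator is additive in each argument; on monomials it is the Jacobi
    identity of g placed in degree i + j + k.\<close>
  define J where "J P Q R =
    pbracket P (pbracket Q R) + pbracket Q (pbracket R P) + pbracket R (pbracket P Q)" for P Q R
  have add: "J (P + P') Q R = J P Q R + J P' Q R" "J P (Q + Q') R = J P Q R + J P Q' R"
    "J P Q (R + R') = J P Q R + J P Q R'" for P P' Q Q' R R'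
    unfolding J_def by (simp_all add: pbracket_add_left pbracket_add_right ac_simps)
  have "J (monom a i) (monom b j) (monom c k) = 0" for a b c i j k
  proof -
    have "J (monom a i) (monom b j) (monom c k) =
        monom (bracket a (bracket b c)) (i + j + k) + monom (bracket b (bracket c a)) (i + j + k) +
        monom (bracket c (bracket a b)) (i + j + k)"
      by (simp add: J_def ac_simps)
    also have "\<dots> = 0" by (simp only: add_monom jacobi monom_eq_0)
    finally show ?thesis .
  qed
  then have "J (monom a i) (monom b j) R = 0" for a b i j
    by (induction R rule: additive_poly_induct) (simp_all add: add)
  then have "J (monom a i) Q R = 0" for a i
    by (induction Q rule: additive_poly_induct) (simp_all add: add)
  then have "J P Q R = 0"
    by (induction P rule: additive_poly_induct) (simp_all add: add)
  then show ?thesis by (simp add: J_def)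
qed

text \<open>Everything proved for an abstract Lie algebra now applies to g[X] itself, including
  Jacobson sums of polynomials, whose generators have a second variable.\<close>

lemma lie_algebra_poly: "lie_algebra pscale pbracket"
proof -
  interpret V: vector_space pscale by (rule vector_space_pscale)
  have "pbracket (pscale l P) Q = pscale l (pbracket P Q)" for l P Q
    by (simp add: pbracket_antisym[of _ Q] pbracket_scale_right V.scale_minus_right)
  then show ?thesis
    by (simp add: lie_algebra_def lie_algebra_axioms_def Vector_Spaces.linear_iff
        vector_space_pscale pbracket_add_left pbracket_add_right pbracket_scale_right
        pbracket_self pbracket_jacobi)
qed

lemma coeff_pbracket_monom_left:
  "poly.coeff (pbracket (monom a k) Q) n = (if n < k then 0 else bracket a (poly.coeff Q (n - k)))"
  by (induction Q rule: additive_poly_induct) (auto simp: pbracket_add_right bracket_add_right)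

lemma degree_pbracket_le: "degree (pbracket P Q) \<le> degree P + degree Q"
  unfolding poly_bracket_def
  by (intro degree_sum_le finite_atMost) (auto intro!: order_trans[OF degree_monom_le])

lemma coeff_0_pbracket: "poly.coeff (pbracket P Q) 0 = bracket (poly.coeff P 0) (poly.coeff Q 0)"
proof (induction P rule: additive_poly_induct)
  case (1 a i)
  show ?case by (cases i) (simp_all add: coeff_pbracket_monom_left)
qed (simp add: pbracket_add_left bracket_add_left)

section \<open>Evaluation at X = 1 and the derivative d/dX\<close>

definition eval1 :: "'g poly \<Rightarrow> 'g" where
  "eval1 P = (\<Sum>i\<le>degree P. poly.coeff P i)"

lemma eval1_eq: "degree P \<le> n \<Longrightarrow> eval1 P = (\<Sum>i\<le>n. poly.coeff P i)"
  unfolding eval1_def by (intro sum.mono_neutral_left) (auto simp: coeff_eq_0)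

lemma eval1_add: "eval1 (P + Q) = eval1 P + eval1 Q"
proof -
  define N where "N = max (degree (P + Q)) (max (degree P) (degree Q))"
  have "degree (P + Q) \<le> N" "degree P \<le> N" "degree Q \<le> N" by (auto simp: N_def)
  then show ?thesis by (simp add: eval1_eq[of _ N] sum.distrib)
qed

lemma eval1_monom [simp]: "eval1 (monom a i) = a"
  by (subst eval1_eq[OF degree_monom_le]) simp

lemma eval1_scale: "eval1 (pscale l P) = l *s eval1 P"
  by (induction P rule: additive_poly_induct) (simp_all add: pscale_add eval1_add scale_right_distrib)

text \<open>Together with \<open>coeff_0_pbracket\<close> this gives two Lie homomorphisms from g[X]
  to g, at X = 1 and at X = 0. Identities in g are obtained by deforming from X = 0 to X =
  1.\<close>

lemma eval1_pbracket: "eval1 (pbracket P Q) = bracket (eval1 P) (eval1 Q)"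
proof (induction P rule: additive_poly_induct)
  case (1 a i)
  show ?case
    by (induction Q rule: additive_poly_induct)
      (simp_all add: pbracket_add_right eval1_add bracket_add_right)
qed (simp add: pbracket_add_left eval1_add bracket_add_left)

lemma eval1_pbracket_pow: "eval1 ((pbracket W ^^ n) P) = (bracket (eval1 W) ^^ n) (eval1 P)"
  by (induction n) (simp_all add: eval1_pbracket)

lemma linear_eval1: "Vector_Spaces.linear pscale scale eval1"
  using vector_space_pscale vector_space_axioms
  by (simp add: Vector_Spaces.linear_iff eval1_add eval1_scale)

lemma linear_coeff: "Vector_Spaces.linear pscale scale (\<lambda>P. poly.coeff P n)"
  using vector_space_pscale vector_space_axioms
  by (simp add: Vector_Spaces.linear_iff)

text \<open>The term i = 0 falls into degree 0 by truncated subtraction, but its coefficient is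
  0.\<close>

definition poly_deriv :: "'g poly \<Rightarrow> 'g poly" where
  "poly_deriv P = (\<Sum>i\<le>degree P. monom (of_nat i *s poly.coeff P i) (i - 1))"

lemma coeff_poly_deriv [simp]:
  "poly.coeff (poly_deriv P) n = of_nat (Suc n) *s poly.coeff P (Suc n)"
proof -
  have "poly.coeff (poly_deriv P) n =
      (\<Sum>i\<le>degree P. if i = Suc n then of_nat i *s poly.coeff P i else 0)"
    unfolding poly_deriv_def coeff_sum
  proof (intro sum.cong refl)
    fix i
    show "poly.coeff (monom (of_nat i *s poly.coeff P i) (i - 1)) n =
        (if i = Suc n then of_nat i *s poly.coeff P i else 0)"
      by (cases i) auto
  qed
  then show ?thesis by (auto simp: coeff_eq_0)
qed

lemma poly_deriv_add: "poly_deriv (P + Q) = poly_deriv P + poly_deriv Q"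
  by (rule poly_eqI) (simp add: scale_right_distrib)

lemma poly_deriv_monom: "poly_deriv (monom a i) = monom (of_nat i *s a) (i - 1)"
  by (rule poly_eqI) (cases i, auto)

lemma poly_deriv_pbracket:
  "poly_deriv (pbracket P Q) = pbracket (poly_deriv P) Q + pbracket P (poly_deriv Q)"
proof (induction P rule: additive_poly_induct)
  case (1 a i)
  show ?case
  proof (induction Q rule: additive_poly_induct)
    case (1 b j)
    show ?case
      by (cases i; cases j)
        (simp_all add: poly_deriv_monom add_monom bracket_scale_left bracket_scale_right
          scale_left_distrib ac_simps del: of_nat_Suc of_nat_add add: of_nat_scale_add[symmetric])
  qed (simp add: pbracket_add_right poly_deriv_add)
qed (simp add: pbracket_add_left poly_deriv_add)

section \<open>Derivations and iterated brackets\<close>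

definition derivation :: "('g \<Rightarrow> 'g) \<Rightarrow> bool" where
  "derivation d \<longleftrightarrow> Vector_Spaces.linear scale scale d \<and>
     (\<forall>x y. d (bracket x y) = bracket (d x) y + bracket x (d y))"

lemma derivation_bracket: "derivation d \<Longrightarrow> d (bracket x y) = bracket (d x) y + bracket x (d y)"
  by (simp add: derivation_def)

lemma derivation_linear: "derivation d \<Longrightarrow> Vector_Spaces.linear scale scale d"
  by (simp add: derivation_def)

text \<open>The commutator of d and ad w is ad (d w). Moving d through the n factors and expanding
  by the Leibniz rule for ad w produces sums of binomials that collapse to n choose j + 1.\<close>

lemma derivation_bracket_pow:
  assumes "derivation d"
  shows "d ((bracket w ^^ n) v) = (bracket w ^^ n) (d v) +
    (\<Sum>j<n. of_nat (n choose Suc j) *s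
       bracket ((bracket w ^^ j) (d w)) ((bracket w ^^ (n - 1 - j)) v))"
proof (induction n)
  case (Suc n)
  define c where "c i j = bracket ((bracket w ^^ i) (d w)) ((bracket w ^^ j) v)" for i j
  have step: "bracket w (c i j) = c (Suc i) j + c i (Suc j)" for i j
    unfolding c_def by (simp add: bracket_bracket[of w])
  have "d ((bracket w ^^ Suc n) v) = bracket (d w) ((bracket w ^^ n) v) +
      bracket w (d ((bracket w ^^ n) v))"
    by (simp add: derivation_bracket[OF assms])
  also have "\<dots> = c 0 n + (bracket w ^^ Suc n) (d v) +
      (\<Sum>j<n. of_nat (n choose Suc j) *s (c (Suc j) (n - 1 - j) + c j (Suc (n - 1 - j))))"
    by (subst Suc.IH)
      (simp add: bracket_add_right bracket_sum_right bracket_scale_right step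
        c_def[symmetric] add.assoc, simp add: c_def)
  also have "(\<Sum>j<n. of_nat (n choose Suc j) *s (c (Suc j) (n - 1 - j) + c j (Suc (n - 1 - j)))) =
      (\<Sum>j<n. of_nat (n choose Suc j) *s c (Suc j) (n - Suc j)) +
      (\<Sum>j<n. of_nat (n choose Suc j) *s c j (n - j))"
    unfolding sum.distrib[symmetric]
    by (intro sum.cong refl) (simp add: scale_right_distrib Suc_diff_Suc)
  \<comment> \<open>The extra \<open>c 0 n\<close> is the j = 0 summand of the shifted first sum,
    and the second sum gains a zero term at j = n. Pascal's rule then merges the two.\<close>
  also have "c 0 n + (bracket w ^^ Suc n) (d v) +
      ((\<Sum>j<n. of_nat (n choose Suc j) *s c (Suc j) (n - Suc j)) +
       (\<Sum>j<n. of_nat (n choose Suc j) *s c j (n - j))) =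
      (bracket w ^^ Suc n) (d v) +
      ((\<Sum>j<Suc n. of_nat (n choose j) *s c j (n - j)) +
       (\<Sum>j<Suc n. of_nat (n choose Suc j) *s c j (n - j)))"
    unfolding sum.lessThan_Suc_shift[of "\<lambda>j. of_nat (n choose j) *s c j (n - j)"]
    by (simp add: ac_simps binomial_eq_0)
  also have "\<dots> = (bracket w ^^ Suc n) (d v) +
      (\<Sum>j<Suc n. of_nat (Suc n choose Suc j) *s c j (Suc n - 1 - j))"
    by (simp only: sum.distrib[symmetric] binomial_Suc_Suc of_nat_scale_add diff_Suc_1)
  finally show ?case by (simp only: c_def)
qed simp

lemma derivation_poly_deriv: "lie_algebra.derivation pscale pbracket poly_deriv"
proof -
  interpret P: lie_algebra pscale pbracket by (rule lie_algebra_poly)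
  have "poly_deriv (pscale l P) = pscale l (poly_deriv P)" for l P
    by (rule poly_eqI) (simp add: scale_left_commute)
  then show ?thesis
    by (simp add: P.derivation_def Vector_Spaces.linear_iff vector_space_pscale poly_deriv_add
        poly_deriv_pbracket)
qed

text \<open>The coefficientwise extension of d is the second derivation of g[X], beside d/dX; the
  chain rule for Jacobson sums comes from comparing the two.\<close>

lemma derivation_map_poly:
  assumes "derivation d"
  shows "lie_algebra.derivation pscale pbracket (map_poly d)"
proof -
  interpret P: lie_algebra pscale pbracket by (rule lie_algebra_poly)
  interpret d: Vector_Spaces.linear scale scale d by (rule derivation_linear[OF assms])
  have add: "map_poly d (P + Q) = map_poly d P + map_poly d Q" for P Q
    by (rule poly_eqI) (simp add: coeff_map_poly d.add)
  have scale: "map_poly d (pscale l P) = pscale l (map_poly d P)" for l P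
    by (rule poly_eqI) (simp add: coeff_map_poly d.scale)
  have "map_poly d (pbracket P Q) = pbracket (map_poly d P) Q + pbracket P (map_poly d Q)" for P Q
  proof (induction P rule: additive_poly_induct)
    case (1 a i)
    show ?case
      by (induction Q rule: additive_poly_induct)
        (simp_all add: map_poly_monom derivation_bracket[OF assms] add_monom add pbracket_add_right)
  qed (simp add: add pbracket_add_left)
  then show ?thesis
    by (simp add: P.derivation_def Vector_Spaces.linear_iff vector_space_pscale add scale)
qed

text \<open>The pencil from b at X = 0 to a + b at X = 1, with leading coefficient a. Constant
  coefficient, value at 1 and top coefficient of an iterated bracket with it therefore see only b, a
  + b and a.\<close>

definition pline :: "'g \<Rightarrow> 'g \<Rightarrow> 'g poly" where
  "pline a b = monom a 1 + monom b 0"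

lemma eval1_pline [simp]: "eval1 (pline a b) = a + b"
  by (simp add: pline_def eval1_add)

lemma poly_deriv_pline [simp]: "poly_deriv (pline a b) = monom a 0"
  by (simp add: pline_def poly_deriv_add poly_deriv_monom)

lemma coeff_pline [simp]: "poly.coeff (pline a b) 0 = b" "poly.coeff (pline a b) (Suc 0) = a"
  by (simp_all add: pline_def)

lemma coeff_pbracket_pline:
  "poly.coeff (pbracket (pline a b) Q) n =
    (case n of 0 \<Rightarrow> 0 | Suc m \<Rightarrow> bracket a (poly.coeff Q m)) + bracket b (poly.coeff Q n)"
  by (cases n) (simp_all add: pline_def pbracket_add_left coeff_pbracket_monom_left)

lemma degree_pline: "degree (pline a b) \<le> 1"
  unfolding pline_def
  by (intro degree_add_le order_trans[OF degree_monom_le]) auto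

lemma degree_pline_pow:
  assumes "degree z \<le> k"
  shows "degree ((pbracket (pline a b) ^^ n) z) \<le> n + k"
proof (induction n)
  case (Suc n)
  then show ?case
    using degree_pbracket_le[of "pline a b" "(pbracket (pline a b) ^^ n) z"] degree_pline[of a b]
    by simp
qed (use assms in simp)

lemma coeff_pline_pow_top:
  assumes "degree z \<le> k"
  shows "poly.coeff ((pbracket (pline a b) ^^ n) z) (n + k) = (bracket a ^^ n) (poly.coeff z k)"
proof (induction n)
  case (Suc n)
  have "poly.coeff ((pbracket (pline a b) ^^ n) z) (Suc n + k) = 0"
    using degree_pline_pow[OF assms, of n a b] by (intro coeff_eq_0) simp
  with Suc show ?case by (simp add: coeff_pbracket_pline)
qed simp

lemma coeff_pline_pow_0:
  "poly.coeff ((pbracket (pline a b) ^^ n) z) 0 = (bracket b ^^ n) (poly.coeff z 0)"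
  by (induction n) (simp_all add: coeff_pbracket_pline)

lemma coeff_pline_pow_eq_0:
  "n < j \<Longrightarrow> poly.coeff ((pbracket (pline a b) ^^ n) (monom z 0)) j = 0"
  using degree_pline_pow[OF degree_monom_le[of z 0], of n a b] by (intro coeff_eq_0) simp

text \<open>
  In terms of Jacobson's elements, \<open>jacobson_gen a b\<close> is \<open>\<Sum>\<^sub>i i s\<^sub>i(a, b) X\<^sup>i\<^sup>-\<^sup>1\<close> and \<open>jacobson_sum a b\<close> is
  \<open>\<Sum>\<^sub>i s\<^sub>i(a, b)\<close>, the integral of the former from 0 to 1.
\<close>

definition jacobson_gen :: "'g \<Rightarrow> 'g \<Rightarrow> 'g poly" where
  "jacobson_gen a b = (pbracket (pline a b) ^^ (CHAR('f) - 1)) (monom a 0)"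

definition jacobson_sum :: "'g \<Rightarrow> 'g \<Rightarrow> 'g" where
  "jacobson_sum a b =
    (\<Sum>i = 1..CHAR('f) - 1. inverse (of_nat i) *s poly.coeff (jacobson_gen a b) (i - 1))"

end

text \<open>A Jacobson sum is a fixed combination of Lie words, hence natural under Lie
  homomorphisms. The two carriers differ because h will be evaluation from g[X] to g.\<close>

lemma jacobson_sum_hom:
  fixes s1 :: "'f::field \<Rightarrow> 'g::ab_group_add \<Rightarrow> 'g" and s2 :: "'f \<Rightarrow> 'h::ab_group_add \<Rightarrow> 'h"
  assumes "lie_algebra s1 b1" "lie_algebra s2 b2"
    and "Vector_Spaces.linear s1 s2 h" "\<And>x y. h (b1 x y) = b2 (h x) (h y)"
  shows "h (lie_algebra.jacobson_sum s1 b1 a b) = lie_algebra.jacobson_sum s2 b2 (h a) (h b)"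
proof -
  interpret A: lie_algebra s1 b1 by fact
  interpret B: lie_algebra s2 b2 by fact
  interpret h: Vector_Spaces.linear s1 s2 h by fact
  have "h (poly.coeff ((A.pbracket (A.pline a b) ^^ n) (monom a 0)) j) =
      poly.coeff ((B.pbracket (B.pline (h a) (h b)) ^^ n) (monom (h a) 0)) j" for n j
  proof (induction n arbitrary: j)
    case (Suc n)
    then show ?case
      by (cases j) (simp_all add: A.coeff_pbracket_pline B.coeff_pbracket_pline assms(4) h.add)
  qed simp
  then show ?thesis
    by (simp add: A.jacobson_sum_def B.jacobson_sum_def A.jacobson_gen_def B.jacobson_gen_def
        h.sum h.scale)
qed

section \<open>Characteristic p: binomials modulo p and the chain rule for Jacobson sums\<close>

locale lie_algebra_prime_char = lie_algebra scale bracket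
  for scale :: "'f::field \<Rightarrow> 'g::ab_group_add \<Rightarrow> 'g" (infixr "*s" 75)
    and bracket :: "'g \<Rightarrow> 'g \<Rightarrow> 'g" +
  assumes prime_CHAR: "prime CHAR('f)"
begin

lemma lie_algebra_prime_char_poly: "lie_algebra_prime_char pscale pbracket"
  by (intro lie_algebra_prime_char.intro lie_algebra_poly lie_algebra_prime_char_axioms.intro
      prime_CHAR)

lemma CHAR_gt_1: "1 < CHAR('f)"
  using prime_CHAR by (rule prime_gt_1_nat)

lemma of_nat_neq_0: "0 < i \<Longrightarrow> i < CHAR('f) \<Longrightarrow> of_nat i \<noteq> (0 :: 'f)"
  by (simp add: of_nat_eq_0_iff_char_dvd nat_dvd_not_less)

lemma of_nat_choose_CHAR:
  assumes "0 < k" "k < CHAR('f)"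
  shows "of_nat (CHAR('f) choose k) = (0 :: 'f)"
  unfolding of_nat_eq_0_iff_char_dvd using assms prime_CHAR by (intro dvd_choose_prime) auto

text \<open>By Pascal's rule the two binomials add up to p choose j + 1, which p divides as 0 < j +
  1 < p.\<close>

lemma of_nat_choose_CHAR_minus_1:
  assumes "Suc j < CHAR('f)"
  shows "of_nat ((CHAR('f) - 1) choose Suc j) = (- of_nat ((CHAR('f) - 1) choose j) :: 'f)"
proof -
  have "of_nat (CHAR('f) choose Suc j) = (0 :: 'f)"
    using assms by (intro of_nat_choose_CHAR) auto
  moreover have "CHAR('f) choose Suc j = ((CHAR('f) - 1) choose j) + ((CHAR('f) - 1) choose Suc j)"
    using CHAR_gt_1 by (metis binomial_Suc_Suc Suc_diff_1 less_trans zero_less_one)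
  ultimately show ?thesis by (simp add: eq_neg_iff_add_eq_0 add.commute)
qed

text \<open>For n = p in \<open>derivation_bracket_pow\<close> every binomial vanishes except the
  one at j = p - 1.\<close>

lemma derivation_bracket_pow_CHAR:
  assumes "derivation d"
  shows "d ((bracket w ^^ CHAR('f)) v) = (bracket w ^^ CHAR('f)) (d v) +
    bracket ((bracket w ^^ (CHAR('f) - 1)) (d w)) v"
proof -
  define p where "p = CHAR('f)"
  have "(\<Sum>j<p. of_nat (p choose Suc j) *s
        bracket ((bracket w ^^ j) (d w)) ((bracket w ^^ (p - 1 - j)) v)) =
      (\<Sum>j\<in>{p - 1}. of_nat (p choose Suc j) *s
        bracket ((bracket w ^^ j) (d w)) ((bracket w ^^ (p - 1 - j)) v))"
    using CHAR_gt_1 of_nat_choose_CHAR unfolding p_def by (intro sum.mono_neutral_right) auto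
  then show ?thesis
    using derivation_bracket_pow[OF assms, of p w v] CHAR_gt_1 by (simp add: p_def)
qed

text \<open>The derivative of (ad w)^(p-1) v in the direction u for w, with v held fixed.\<close>

definition cross_sum :: "'g \<Rightarrow> 'g \<Rightarrow> 'g \<Rightarrow> 'g" where
  "cross_sum w u v = (\<Sum>j<CHAR('f) - 1. of_nat ((CHAR('f) - 1) choose Suc j) *s
      bracket ((bracket w ^^ j) u) ((bracket w ^^ (CHAR('f) - 1 - 1 - j)) v))"

lemma derivation_bracket_pow_CHAR_minus_1:
  "derivation d \<Longrightarrow> d ((bracket w ^^ (CHAR('f) - 1)) v) =
    (bracket w ^^ (CHAR('f) - 1)) (d v) + cross_sum w (d w) v"
  unfolding cross_sum_def by (rule derivation_bracket_pow)

text \<open>Reversing the sum swaps the roles of u and v at the cost of two signs: one from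
  antisymmetry of the bracket, one from consecutive binomials being opposite modulo p.\<close>

lemma cross_sum_commute: "cross_sum w u v = cross_sum w v u"
proof -
  define n where "n = CHAR('f) - 1"
  have "cross_sum w u v = (\<Sum>j<n. of_nat (n choose Suc (n - Suc j)) *s
      bracket ((bracket w ^^ (n - Suc j)) u) ((bracket w ^^ (n - 1 - (n - Suc j))) v))"
    unfolding cross_sum_def n_def[symmetric] by (rule sum.nat_diff_reindex[symmetric])
  also have "\<dots> = (\<Sum>j<n. of_nat (n choose Suc j) *s
      bracket ((bracket w ^^ j) v) ((bracket w ^^ (n - 1 - j)) u))"
  proof (intro sum.cong refl)
    fix j assume "j \<in> {..<n}"
    then have j: "j < n" by simp
    then have "n choose Suc (n - Suc j) = n choose j"
      by (metis Suc_diff_Suc binomial_symmetric less_imp_le)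
    moreover have "n - 1 - (n - Suc j) = j" using j by auto
    moreover have "of_nat (n choose Suc j) = (- of_nat (n choose j) :: 'f)"
      unfolding n_def using j by (intro of_nat_choose_CHAR_minus_1) (simp add: n_def)
    ultimately show "of_nat (n choose Suc (n - Suc j)) *s
        bracket ((bracket w ^^ (n - Suc j)) u) ((bracket w ^^ (n - 1 - (n - Suc j))) v) =
      of_nat (n choose Suc j) *s bracket ((bracket w ^^ j) v) ((bracket w ^^ (n - 1 - j)) u)"
      by (simp add: bracket_antisym[of "(bracket w ^^ (n - Suc j)) u"])
  qed
  finally show ?thesis by (simp add: cross_sum_def n_def)
qed

text \<open>For Z built from the pencil, the three terms on the right become the contributions of a
  + b, a and b.\<close>

lemma sum_coeff_eq_eval1:
  assumes "degree Z \<le> CHAR('f)"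
  shows "(\<Sum>i = 1..CHAR('f) - 1. poly.coeff Z i) =
    eval1 Z - poly.coeff Z (CHAR('f)) - poly.coeff Z 0"
proof -
  obtain n where n: "CHAR('f) = Suc n" using CHAR_gt_1 by (cases "CHAR('f)") auto
  have "eval1 Z = (\<Sum>i\<le>Suc n. poly.coeff Z i)" using assms n by (intro eval1_eq) simp
  also have "\<dots> = poly.coeff Z 0 + (\<Sum>i = 1..n. poly.coeff Z i) + poly.coeff Z (Suc n)"
    by (simp add: sum.atMost_shift atLeast1_atMost_eq_remove0 atMost_atLeast0 sum.atLeast_Suc_atMost)
  finally show ?thesis by (simp add: n)
qed

text \<open>
  If \<open>jacobson_sum a b = F (a + b) - F a - F b\<close> for a function \<open>F\<close> with differential
  \<open>w \<mapsto> (ad w)\<^sup>p\<^sup>-\<^sup>1\<close>, then this is the chain rule. The closedness of that 1-form is the symmetry of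
  \<^const>\<open>cross_sum\<close>.
\<close>

lemma derivation_jacobson_sum:
  assumes "derivation d"
  shows "d (jacobson_sum a b) = (bracket (a + b) ^^ (CHAR('f) - 1)) (d a + d b) -
    (bracket a ^^ (CHAR('f) - 1)) (d a) - (bracket b ^^ (CHAR('f) - 1)) (d b)"
proof -
  interpret P: lie_algebra_prime_char pscale pbracket by (rule lie_algebra_prime_char_poly)
  interpret d: Vector_Spaces.linear scale scale d by (rule derivation_linear[OF assms])
  define w where "w = pline a b"
  define D where "D = map_poly d"
  define N where "N = CHAR('f) - 1"
  have D_add: "D (P + Q) = D P + D Q" for P Q
    unfolding D_def by (rule poly_eqI) (simp add: coeff_map_poly d.add)
  have D_monom: "D (monom x i) = monom (d x) i" for x i
    unfolding D_def by (rule map_poly_monom) simp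
  define Z where "Z = (pbracket w ^^ N) (D w)"
  have Dw: "D w = pline (d a) (d b)" by (simp add: w_def pline_def D_add D_monom)
  have deriv_w: "poly_deriv w = monom a 0" "poly_deriv (D w) = monom (d a) 0"
    by (simp_all add: w_def Dw[unfolded w_def])
  \<comment> \<open>Here \<open>monom a 0\<close> is dw/dX, so the generator is (ad w)^(p-1)
    (dw/dX), while Z is (ad w)^(p-1) (D w). Since D and d/dX commute on w, D of the first and d/dX
    of the second differ only in the order of the arguments of the cross sum.\<close>
  have "D (jacobson_gen a b) = (pbracket w ^^ N) (monom (d a) 0) + P.cross_sum w (D w) (monom a 0)"
    using P.derivation_bracket_pow_CHAR_minus_1[OF derivation_map_poly[OF assms], of w "monom a 0"]
    by (simp add: jacobson_gen_def w_def N_def D_def[symmetric] D_monom)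
  also have "\<dots> = poly_deriv Z"
    using P.derivation_bracket_pow_CHAR_minus_1[OF derivation_poly_deriv, of w "D w"]
    by (simp add: Z_def N_def deriv_w P.cross_sum_commute)
  finally have eq: "d (poly.coeff (jacobson_gen a b) i) = of_nat (Suc i) *s poly.coeff Z (Suc i)" for i
    by (metis D_def coeff_map_poly coeff_poly_deriv d.zero)
  \<comment> \<open>The factor i from d/dX cancels the weight 1/i of the Jacobson sum.\<close>
  have "d (jacobson_sum a b) = (\<Sum>i = 1..N. inverse (of_nat i) *s (of_nat i *s poly.coeff Z i))"
    unfolding jacobson_sum_def d.sum d.scale N_def[symmetric] by (intro sum.cong refl) (auto simp: eq)
  also have "\<dots> = (\<Sum>i = 1..N. poly.coeff Z i)"
    using CHAR_gt_1 by (intro sum.cong refl) (auto simp: N_def of_nat_neq_0)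
  finally have "d (jacobson_sum a b) = (\<Sum>i = 1..CHAR('f) - 1. poly.coeff Z i)"
    by (simp only: N_def)
  moreover have "degree Z \<le> N + 1"
    unfolding Z_def w_def by (rule degree_pline_pow) (use Dw degree_pline in \<open>simp add: w_def\<close>)
  moreover have "poly.coeff Z (N + 1) = (bracket a ^^ N) (d a)"
    unfolding Z_def w_def using degree_pline[of "d a" "d b"] Dw
    by (subst coeff_pline_pow_top) (auto simp: w_def)
  moreover have "poly.coeff Z 0 = (bracket b ^^ N) (d b)"
    unfolding Z_def w_def using Dw by (subst coeff_pline_pow_0) (auto simp: w_def)
  moreover have "eval1 Z = (bracket (a + b) ^^ N) (d a + d b)"
    unfolding Z_def eval1_pbracket_pow Dw by (simp add: w_def)
  moreover have "N + 1 = CHAR('f)" using CHAR_gt_1 by (simp add: N_def)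
  ultimately show ?thesis using sum_coeff_eq_eval1[of Z] by (simp only: N_def)
qed

text \<open>The terms have i factors u and p - i factors v with 1 <= i <= p - 1. One of u, v is
  constant and the other at most linear, so the degree stays below p, the range where a zero
  derivative forces a constant.\<close>

lemma degree_jacobson_sum_less:
  assumes "degree u + degree v \<le> 1"
  shows "degree (lie_algebra.jacobson_sum pscale pbracket u v) < CHAR('f)"
proof -
  interpret P: lie_algebra pscale pbracket by (rule lie_algebra_poly)
  \<comment> \<open>The coefficient of degree j in the outer variable collects words with j brackets
    by u, n - j brackets by v, and the starting vector u.\<close>
  have *: "degree (poly.coeff ((P.pbracket (P.pline u v) ^^ n) (monom u 0)) j)
      \<le> j * degree u + (n - j) * degree v + degree u" if "j \<le> n" for n j
    using that
  proof (induction n arbitrary: j)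
    case (Suc n)
    let ?c = "\<lambda>j. poly.coeff ((P.pbracket (P.pline u v) ^^ n) (monom u 0)) j"
    have 1: "degree (pbracket v (?c j)) \<le> j * degree u + (Suc n - j) * degree v + degree u"
    proof (cases "j = Suc n")
      case True
      then show ?thesis by (simp add: P.coeff_pline_pow_eq_0)
    next
      case False
      then obtain m where m: "n = j + m" using Suc.prems by (metis le_SucE le_Suc_ex)
      then have "Suc n - j = Suc m" by simp
      then show ?thesis
        using Suc.IH[of j] m degree_pbracket_le[of v "?c j"] by simp
    qed
    show ?case
    proof (cases j)
      case 0
      then show ?thesis using 1 by (simp add: P.coeff_pbracket_pline)
    next
      case (Suc k)
      have "degree (pbracket u (?c k)) \<le> j * degree u + (Suc n - j) * degree v + degree u"
        using Suc.IH[of k] Suc.prems Suc degree_pbracket_le[of u "?c k"]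
        by simp
      with 1 Suc show ?thesis
        by (auto simp: P.coeff_pbracket_pline intro!: degree_add_le)
    qed
  qed simp
  have "degree (pscale (inverse (of_nat i)) (poly.coeff (P.jacobson_gen u v) (i - 1))) < CHAR('f)"
    if i: "i \<in> {1..CHAR('f) - 1}" for i
  proof -
    have "degree (pscale (inverse (of_nat i)) (poly.coeff (P.jacobson_gen u v) (i - 1)))
        \<le> degree (poly.coeff (P.jacobson_gen u v) (i - 1))"
      by (rule map_poly_degree_leq)
    also have "\<dots> \<le> (i - 1) * degree u + (CHAR('f) - 1 - (i - 1)) * degree v + degree u"
      unfolding P.jacobson_gen_def using i by (intro *) auto
    also have "\<dots> < CHAR('f)"
    proof -
      from assms consider "degree u = 0" "degree v = 0" | "degree u = 1" "degree v = 0"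
        | "degree u = 0" "degree v = 1" by linarith
      then show ?thesis using i CHAR_gt_1 by cases auto
    qed
    finally show ?thesis .
  qed
  then show ?thesis
    unfolding P.jacobson_sum_def using CHAR_gt_1 by (intro degree_sum_less) auto
qed

text \<open>In characteristic p the derivative also kills X^p; below that degree the factors n are
  invertible.\<close>

lemma poly_deriv_eq_0_imp_eq_0:
  assumes "poly_deriv P = 0" "degree P < CHAR('f)" "poly.coeff P 0 = 0"
  shows "P = 0"
proof (rule poly_eqI)
  fix n
  show "poly.coeff P n = poly.coeff 0 n"
  proof (cases n)
    case (Suc m)
    have "of_nat (Suc m) *s poly.coeff P (Suc m) = 0"
      using assms(1) by (metis coeff_0 coeff_poly_deriv)
    then show ?thesis
      using Suc assms(2) of_nat_neq_0[of "Suc m"]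
      by (cases "Suc m < CHAR('f)") (auto simp: coeff_eq_0 simp del: of_nat_Suc)
  qed (use assms in simp)
qed

section \<open>Symmetry, cocycle identity and homogeneity of Jacobson sums\<close>

lemma jacobson_sum_zero_left [simp]: "jacobson_sum 0 b = 0"
  by (simp add: jacobson_sum_def jacobson_gen_def lie_algebra.bracket_pow_zero[OF lie_algebra_poly])

lemma jacobson_gen_zero_right: "jacobson_gen a 0 = 0"
proof -
  interpret P: lie_algebra pscale pbracket by (rule lie_algebra_poly)
  show ?thesis
    unfolding jacobson_gen_def using CHAR_gt_1
    by (intro P.bracket_pow_eq_0) (simp_all add: pline_def bracket_self)
qed

lemma jacobson_sum_zero_right [simp]: "jacobson_sum a 0 = 0"
  by (simp add: jacobson_sum_def jacobson_gen_zero_right)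

lemma jacobson_sum_eval1:
  "eval1 (lie_algebra.jacobson_sum pscale pbracket u v) = jacobson_sum (eval1 u) (eval1 v)"
  by (intro jacobson_sum_hom lie_algebra_poly lie_algebra_axioms linear_eval1 eval1_pbracket)

lemma jacobson_sum_coeff_0:
  "poly.coeff (lie_algebra.jacobson_sum pscale pbracket u v) 0 =
    jacobson_sum (poly.coeff u 0) (poly.coeff v 0)"
  by (intro jacobson_sum_hom lie_algebra_poly lie_algebra_axioms linear_coeff coeff_0_pbracket)

lemma poly_deriv_jacobson_sum:
  "poly_deriv (lie_algebra.jacobson_sum pscale pbracket u v) =
    (pbracket (u + v) ^^ (CHAR('f) - 1)) (poly_deriv u + poly_deriv v) -
    (pbracket u ^^ (CHAR('f) - 1)) (poly_deriv u) - (pbracket v ^^ (CHAR('f) - 1)) (poly_deriv v)"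
  by (intro lie_algebra_prime_char.derivation_jacobson_sum lie_algebra_prime_char_poly
      derivation_poly_deriv)

lemma poly_deriv_diff: "poly_deriv (P - Q) = poly_deriv P - poly_deriv Q"
  by (rule poly_eqI) (simp add: scale_right_diff_distrib)

text \<open>Replace a by a X. The difference of the two sides has derivative 0 by the chain rule,
  degree below p, and value 0 at X = 0, so it vanishes; then put X = 1.\<close>

lemma jacobson_sum_commute: "jacobson_sum a b = jacobson_sum b a"
proof -
  interpret P: lie_algebra pscale pbracket by (rule lie_algebra_poly)
  define u v where "u = monom a 1" and "v = monom b 0"
  have deg: "degree u + degree v \<le> 1"
    using degree_monom_le[of a 1] degree_monom_le[of b 0] by (simp add: u_def v_def)
  have "P.jacobson_sum u v - P.jacobson_sum v u = 0"
  proof (rule poly_deriv_eq_0_imp_eq_0)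
    show "poly_deriv (P.jacobson_sum u v - P.jacobson_sum v u) = 0"
      by (simp add: poly_deriv_diff poly_deriv_jacobson_sum add.commute)
    show "degree (P.jacobson_sum u v - P.jacobson_sum v u) < CHAR('f)"
      using deg by (intro degree_diff_less degree_jacobson_sum_less) (simp_all add: add.commute)
  qed (simp add: jacobson_sum_coeff_0 u_def v_def)
  then have "eval1 (P.jacobson_sum u v) = eval1 (P.jacobson_sum v u)" by simp
  then show ?thesis by (simp add: jacobson_sum_eval1 u_def v_def)
qed

text \<open>The same deformation, scaling only a: the derivatives of the four terms telescope, and
  at X = 0 both sides are the Jacobson sum of b and c.\<close>

lemma jacobson_sum_cocycle:
  "jacobson_sum a b + jacobson_sum (a + b) c = jacobson_sum b c + jacobson_sum a (b + c)"
proof -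
  interpret P: lie_algebra pscale pbracket by (rule lie_algebra_poly)
  define x y z where "x = monom a 1" and "y = monom b 0" and "z = monom c 0"
  have d: "degree x \<le> 1" "degree y = 0" "degree z = 0"
    using degree_monom_le[of b 0] degree_monom_le[of c 0] by (simp_all add: x_def y_def z_def degree_monom_le)
  then have deg: "degree x + degree y \<le> 1" "degree (x + y) + degree z \<le> 1"
      "degree y + degree z \<le> 1" "degree x + degree (y + z) \<le> 1"
    using degree_add_le_max[of x y] degree_add_le_max[of y z] by auto
  define \<Delta> where "\<Delta> = P.jacobson_sum x y + P.jacobson_sum (x + y) z -
    P.jacobson_sum y z - P.jacobson_sum x (y + z)"
  have "\<Delta> = 0"
  proof (rule poly_deriv_eq_0_imp_eq_0)
    show "poly_deriv \<Delta> = 0"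
      unfolding \<Delta>_def
      by (simp add: poly_deriv_diff poly_deriv_add poly_deriv_jacobson_sum add.assoc)
    show "degree \<Delta> < CHAR('f)"
      unfolding \<Delta>_def
      by (intro degree_diff_less degree_add_less degree_jacobson_sum_less deg)
  qed (simp add: \<Delta>_def jacobson_sum_coeff_0 x_def y_def z_def)
  then have "eval1 (P.jacobson_sum x y + P.jacobson_sum (x + y) z) =
      eval1 (P.jacobson_sum y z + P.jacobson_sum x (y + z))"
    by (simp add: \<Delta>_def algebra_simps)
  then show ?thesis by (simp add: eval1_add jacobson_sum_eval1 x_def y_def z_def)
qed

lemma jacobson_sum_parallel: "jacobson_sum (l *s a) (m *s a) = 0"
proof -
  interpret P: lie_algebra pscale pbracket by (rule lie_algebra_poly)
  have "jacobson_gen (l *s a) (m *s a) = 0"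
    unfolding jacobson_gen_def using CHAR_gt_1
    by (intro P.bracket_pow_eq_0)
      (simp_all add: pline_def pbracket_add_left bracket_scale_left bracket_scale_right bracket_self)
  then show ?thesis by (simp add: jacobson_sum_def)
qed

text \<open>The generator has total degree p: p - 1 brackets with the pencil and one starting
  vector.\<close>

lemma jacobson_sum_scale: "jacobson_sum (l *s a) (l *s b) = l ^ CHAR('f) *s jacobson_sum a b"
proof -
  interpret P: lie_algebra pscale pbracket by (rule lie_algebra_poly)
  have "pline (l *s a) (l *s b) = pscale l (pline a b)" "monom (l *s a) 0 = pscale l (monom a 0)"
    by (simp_all add: pline_def pscale_add)
  then have "jacobson_gen (l *s a) (l *s b) = pscale (l ^ (CHAR('f) - 1) * l) (jacobson_gen a b)"
    unfolding jacobson_gen_def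
    by (simp only: P.bracket_pow_scale_left P.bracket_pow_scale P.scale_scale mult.commute)
  also have "l ^ (CHAR('f) - 1) * l = l ^ CHAR('f)"
    using CHAR_gt_1 by (simp add: power_Suc2[symmetric] del: power_Suc)
  finally show ?thesis
    by (simp add: jacobson_sum_def scale_sum_right mult.commute)
qed

text \<open>The X-derivative of Z = (ad (a X + b))^p v is the bracket of the generator with v.
  Integrating the coefficients strictly between degrees 0 and p gives the Jacobson sum; the two
  extreme coefficients are the p-th powers of ad b and ad a.\<close>

lemma bracket_pow_CHAR_add:
  "(bracket (a + b) ^^ CHAR('f)) v = (bracket a ^^ CHAR('f)) v + (bracket b ^^ CHAR('f)) v +
    bracket (jacobson_sum a b) v"
proof -
  interpret P: lie_algebra_prime_char pscale pbracket by (rule lie_algebra_prime_char_poly)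
  define Z where "Z = (pbracket (pline a b) ^^ CHAR('f)) (monom v 0)"
  have "poly_deriv Z = pbracket (jacobson_gen a b) (monom v 0)"
    using P.derivation_bracket_pow_CHAR[OF derivation_poly_deriv, of "pline a b" "monom v 0"]
    by (simp add: Z_def jacobson_gen_def poly_deriv_monom)
  \<comment> \<open>Puts the constant polynomial on the left, where
    \<open>coeff_pbracket_monom_left\<close> reads off coefficients.\<close>
  also have "\<dots> = - pbracket (monom v 0) (jacobson_gen a b)" by (rule pbracket_antisym)
  finally have "of_nat (Suc i) *s poly.coeff Z (Suc i) = - bracket v (poly.coeff (jacobson_gen a b) i)"
    for i
    by (metis (no_types, lifting) coeff_minus coeff_pbracket_monom_left coeff_poly_deriv diff_zero not_less_zero)
  then have eq: "of_nat (Suc i) *s poly.coeff Z (Suc i) = bracket (poly.coeff (jacobson_gen a b) i) v"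
    for i
    by (simp only: bracket_antisym[of _ v])
  have "bracket (jacobson_sum a b) v =
      (\<Sum>i = 1..CHAR('f) - 1. inverse (of_nat i) *s (of_nat i *s poly.coeff Z i))"
    unfolding jacobson_sum_def bracket_sum_left bracket_scale_left
  proof (intro sum.cong refl)
    fix i assume "i \<in> {1..CHAR('f) - 1}"
    then show "inverse (of_nat i) *s bracket (poly.coeff (jacobson_gen a b) (i - 1)) v =
        inverse (of_nat i) *s (of_nat i *s poly.coeff Z i)"
      using eq[of "i - 1"] by simp
  qed
  also have "\<dots> = (\<Sum>i = 1..CHAR('f) - 1. poly.coeff Z i)"
    using CHAR_gt_1 by (intro sum.cong refl) (auto simp: of_nat_neq_0)
  also have "\<dots> = eval1 Z - poly.coeff Z (CHAR('f)) - poly.coeff Z 0"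
    using degree_pline_pow[OF degree_monom_le[of v 0], of "CHAR('f)" a b]
    by (intro sum_coeff_eq_eval1) (simp add: Z_def)
  also have "eval1 Z = (bracket (a + b) ^^ CHAR('f)) v"
    by (simp add: Z_def eval1_pbracket_pow)
  also have "poly.coeff Z 0 = (bracket b ^^ CHAR('f)) v"
    by (simp add: Z_def coeff_pline_pow_0)
  also have "poly.coeff Z (CHAR('f)) = (bracket a ^^ CHAR('f)) v"
    using coeff_pline_pow_top[OF degree_monom_le[of v 0], of "CHAR('f)" a b] by (simp add: Z_def)
  finally show ?thesis by simp
qed

section \<open>Jacobson's theorem\<close>

lemma jacobson_elements_iff:
  "jacobson_elements a b s \<longleftrightarrow>
    (\<forall>i\<in>{1..CHAR('f) - 1}. s i = inverse (of_nat i) *s poly.coeff (jacobson_gen a b) (i - 1))"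
proof -
  define N where "N = CHAR('f) - 1"
  obtain M where N: "N = Suc M" using CHAR_gt_1 by (cases N) (auto simp: N_def)
  have nz: "of_nat (Suc m) \<noteq> (0 :: 'f)" if "m < N" for m
    using that by (intro of_nat_neq_0) (auto simp: N_def)
  \<comment> \<open>The degree bound allows degree p - 1, but that coefficient is (ad a)^(p-1) a =
    0; so the generator fits the degrees 0 to p - 2 of the defining equation.\<close>
  have gen_0: "poly.coeff (jacobson_gen a b) m = 0" if "N \<le> m" for m
  proof (cases "m = N")
    case True
    have "poly.coeff (jacobson_gen a b) (N + 0) = (bracket a ^^ N) a"
      using coeff_pline_pow_top[OF degree_monom_le[of a 0], of N a b]
      by (simp add: jacobson_gen_def N_def)
    also have "\<dots> = 0" using N by (intro bracket_pow_eq_0) (simp_all add: bracket_self)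
    finally show ?thesis using True by simp
  next
    case False
    then show ?thesis
      unfolding jacobson_gen_def using that by (intro coeff_pline_pow_eq_0) (simp add: N_def)
  qed
  have coeff: "poly.coeff (\<Sum>i = 1..N. monom (of_nat i *s s i) (i - 1)) m =
      (if m < N then of_nat (Suc m) *s s (Suc m) else 0)" for m
  proof -
    have "poly.coeff (\<Sum>i = 1..N. monom (of_nat i *s s i) (i - 1)) m =
        (\<Sum>i = 1..N. if i = Suc m then of_nat i *s s i else 0)"
      unfolding coeff_sum by (intro sum.cong refl) auto
    then show ?thesis by auto
  qed
  have "jacobson_elements a b s \<longleftrightarrow>
      (\<forall>m. poly.coeff (jacobson_gen a b) m = (if m < N then of_nat (Suc m) *s s (Suc m) else 0))"
    unfolding jacobson_elements_def poly_eq_iff N_def[symmetric] coeff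
    by (simp only: jacobson_gen_def pline_def N_def)
  also have "\<dots> \<longleftrightarrow> (\<forall>m<N. poly.coeff (jacobson_gen a b) m = of_nat (Suc m) *s s (Suc m))"
  proof (intro iffI allI impI)
    fix m
    assume "\<forall>m<N. poly.coeff (jacobson_gen a b) m = of_nat (Suc m) *s s (Suc m)"
    then show "poly.coeff (jacobson_gen a b) m = (if m < N then of_nat (Suc m) *s s (Suc m) else 0)"
      using gen_0[of m] by (cases "m < N") (simp_all del: of_nat_Suc)
  next
    fix m
    assume "\<forall>m. poly.coeff (jacobson_gen a b) m = (if m < N then of_nat (Suc m) *s s (Suc m) else 0)"
      and "m < N"
    then show "poly.coeff (jacobson_gen a b) m = of_nat (Suc m) *s s (Suc m)"
      by (simp del: of_nat_Suc)
  qed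
  also have "\<dots> \<longleftrightarrow> (\<forall>m<N. s (Suc m) = inverse (of_nat (Suc m)) *s poly.coeff (jacobson_gen a b) m)"
  proof (rule all_cong1, rule imp_cong[OF refl])
    fix m assume "m < N"
    from nz[OF this] show "(poly.coeff (jacobson_gen a b) m = of_nat (Suc m) *s s (Suc m)) =
        (s (Suc m) = inverse (of_nat (Suc m)) *s poly.coeff (jacobson_gen a b) m)"
      by (auto simp del: of_nat_Suc)
  qed
  also have "\<dots> \<longleftrightarrow> (\<forall>i\<in>{1..N}. s i = inverse (of_nat i) *s poly.coeff (jacobson_gen a b) (i - 1))"
  proof safe
    fix i assume *: "\<forall>m<N. s (Suc m) = inverse (of_nat (Suc m)) *s poly.coeff (jacobson_gen a b) m"
      and "i \<in> {1..N}"
    then show "s i = inverse (of_nat i) *s poly.coeff (jacobson_gen a b) (i - 1)"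
      using *[rule_format, of "i - 1"] by auto
  qed (auto simp del: of_nat_Suc)
  finally show ?thesis by (simp only: N_def)
qed

text \<open>The defining equation fixes s on 1, ..., p - 1, the only values summed, so the
  existential in the axiom turns into an explicit formula.\<close>

lemma ex_jacobson_elements_iff:
  "(\<exists>s. jacobson_elements a b s \<and> x = y + (\<Sum>i = 1..CHAR('f) - 1. s i)) \<longleftrightarrow>
    x = y + jacobson_sum a b"
proof
  assume "\<exists>s. jacobson_elements a b s \<and> x = y + (\<Sum>i = 1..CHAR('f) - 1. s i)"
  then show "x = y + jacobson_sum a b"
    by (auto simp: jacobson_elements_iff jacobson_sum_def)
next
  assume "x = y + jacobson_sum a b"
  then show "\<exists>s. jacobson_elements a b s \<and> x = y + (\<Sum>i = 1..CHAR('f) - 1. s i)"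
    by (intro exI[of _ "\<lambda>i. inverse (of_nat i) *s poly.coeff (jacobson_gen a b) (i - 1)"])
      (simp add: jacobson_elements_iff jacobson_sum_def)
qed

lemma restricted_lie_algebra_iff:
  "restricted_lie_algebra scale bracket pmap \<longleftrightarrow>
    (\<forall>a. bracket (pmap a) = bracket a ^^ CHAR('f)) \<and>
    (\<forall>l a. pmap (l *s a) = l ^ CHAR('f) *s pmap a) \<and>
    (\<forall>a b. pmap (a + b) = pmap a + pmap b + jacobson_sum a b)"
  unfolding restricted_lie_algebra_def restricted_lie_algebra_axioms_def ex_jacobson_elements_iff
  by (simp add: lie_algebra_axioms prime_CHAR)

section \<open>The twisted sum on g x g and its sections\<close>

definition twisted_add :: "'g \<times> 'g \<Rightarrow> 'g \<times> 'g \<Rightarrow> 'g \<times> 'g" where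
  "twisted_add x y = (fst x + fst y, snd x + snd y + jacobson_sum (fst x) (fst y))"

text \<open>Associativity is the cocycle identity, commutativity the symmetry of Jacobson sums. The
  commutative monoid supplies the finite sums \<open>twisted.F\<close> used to extend from a
  basis.\<close>

sublocale twisted: comm_monoid_set twisted_add "(0, 0)"
proof
  fix x y z :: "'g \<times> 'g"
  show "twisted_add (twisted_add x y) z = twisted_add x (twisted_add y z)"
    using jacobson_sum_cocycle[of "fst x" "fst y" "fst z"]
    by (simp add: twisted_add_def ac_simps)
  show "twisted_add x y = twisted_add y x"
    by (simp add: twisted_add_def ac_simps jacobson_sum_commute[of "fst x"])
  show "twisted_add x (0, 0) = x"
    by (simp add: twisted_add_def)
qed

theorem ex1_restricted_lie_algebra:
  assumes indep: "independent B" and span: "span B = UNIV"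
    and y: "\<And>b. b \<in> B \<Longrightarrow> bracket (y b) = bracket b ^^ CHAR('f)"
  shows "\<exists>!pmap. restricted_lie_algebra scale bracket pmap \<and> (\<forall>b\<in>B. pmap b = y b)"
proof (rule ex_ex1I)
  let ?p = "CHAR('f)"
  define r where "r = representation B"
  \<comment> \<open>The lift of the multiple l b of a basis vector, as p-semilinearity dictates;
    \<open>\<sigma>\<close> adds up the lifts of the components of x, and its second coordinate will
    be the p-mapping.\<close>
  define t where "t l b = (l *s b, l ^ ?p *s y b)" for l b
  define \<sigma> where "\<sigma> x = twisted.F (\<lambda>b. t (r x b) b) {b. r x b \<noteq> 0}" for x
  have p_pos: "0 < ?p" using CHAR_gt_1 by simp
  have t_0: "t 0 b = (0, 0)" for b
    using p_pos by (simp add: t_def power_0_left)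
  \<comment> \<open>Parallel vectors have Jacobson sum 0, and l^p is additive in l.\<close>
  have t_add: "t (l + m) b = twisted_add (t l b) (t m b)" for l m b
    using freshmans_dream[OF prime_CHAR refl, of l m]
    by (simp add: t_def twisted_add_def scale_left_distrib jacobson_sum_parallel)
  have supp: "finite {b. r x b \<noteq> 0}" "{b. r x b \<noteq> 0} \<subseteq> B" for x
    using finite_representation representation_ne_zero by (auto simp: r_def)
  \<comment> \<open>Since \<open>t 0 b\<close> is neutral, expansions of different vectors can be
    summed over a common finite set.\<close>
  have \<sigma>_eq: "\<sigma> x = twisted.F (\<lambda>b. t (r x b) b) A" if "finite A" "{b. r x b \<noteq> 0} \<subseteq> A" for x A
    unfolding \<sigma>_def using that by (intro twisted.mono_neutral_left) (auto simp: t_0)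
  have r_add: "r (x + z) b = r x b + r z b" and r_scale: "r (l *s x) b = l * r x b" for x z l b
    using indep span by (simp_all add: r_def representation_add representation_scale)
  have \<sigma>_add: "\<sigma> (x + z) = twisted_add (\<sigma> x) (\<sigma> z)" for x z
  proof -
    let ?A = "{b. r x b \<noteq> 0} \<union> {b. r z b \<noteq> 0}"
    have "\<sigma> (x + z) = twisted.F (\<lambda>b. t (r (x + z) b) b) ?A"
      by (intro \<sigma>_eq) (auto simp: supp r_add)
    also have "\<dots> = twisted_add (twisted.F (\<lambda>b. t (r x b) b) ?A) (twisted.F (\<lambda>b. t (r z b) b) ?A)"
      by (simp add: r_add t_add twisted.distrib)
    also have "\<dots> = twisted_add (\<sigma> x) (\<sigma> z)"
      using supp by (subst (1 2) \<sigma>_eq[of ?A]) auto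
    finally show ?thesis .
  qed
  have fst_F: "fst (twisted.F g A) = (\<Sum>b\<in>A. fst (g b))" for g :: "'g \<Rightarrow> 'g \<times> 'g" and A
    by (induction A rule: infinite_finite_induct) (simp_all add: twisted_add_def)
  have fst_\<sigma>: "fst (\<sigma> x) = x" for x
    using sum_nonzero_representation_eq[OF indep, of x] span
    by (simp add: \<sigma>_def fst_F t_def r_def)
  \<comment> \<open>Scalar multiplication of the twisted space.\<close>
  define m where "m l u = (l *s fst u, l ^ ?p *s snd u)" for l and u :: "'g \<times> 'g"
  have m_add: "m l (twisted_add u v) = twisted_add (m l u) (m l v)" for l u v
    by (simp add: m_def twisted_add_def scale_right_distrib jacobson_sum_scale)
  have m_F: "m l (twisted.F g A) = twisted.F (\<lambda>b. m l (g b)) A" for l g and A :: "'g set"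
    by (induction A rule: infinite_finite_induct) (simp_all add: m_add, simp_all add: m_def)
  have \<sigma>_scale: "\<sigma> (l *s x) = m l (\<sigma> x)" for l x
  proof -
    have "\<sigma> (l *s x) = twisted.F (\<lambda>b. t (r (l *s x) b) b) {b. r x b \<noteq> 0}"
      by (intro \<sigma>_eq) (auto simp: supp r_scale)
    also have "\<dots> = m l (\<sigma> x)"
      by (simp add: \<sigma>_def m_F r_scale) (simp add: t_def m_def power_mult_distrib)
    finally show ?thesis .
  qed
  \<comment> \<open>The pairs (x, u) with ad u = (ad x)^p are closed under twisted addition by
    \<open>bracket_pow_CHAR_add\<close>; they contain the lifts of basis vectors, hence all values
    of \<open>\<sigma>\<close>.\<close>
  have ad_add: "bracket (snd (twisted_add u v)) = bracket (fst (twisted_add u v)) ^^ ?p"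
    if "bracket (snd u) = bracket (fst u) ^^ ?p" "bracket (snd v) = bracket (fst v) ^^ ?p" for u v
    using that by (auto simp: twisted_add_def bracket_add_left bracket_pow_CHAR_add fun_eq_iff)
  have ad_t: "bracket (snd (t l b)) = bracket (fst (t l b)) ^^ ?p" if "b \<in> B" for l b
    using y[OF that] by (auto simp: t_def bracket_scale_left bracket_pow_scale_left fun_eq_iff)
  have ad_F: "bracket (snd (twisted.F (\<lambda>b. t (r x b) b) A)) =
      bracket (fst (twisted.F (\<lambda>b. t (r x b) b) A)) ^^ ?p" if "A \<subseteq> B" for x A
    using that
  proof (induction A rule: infinite_finite_induct)
    case (insert b A)
    then show ?case by (simp add: ad_add ad_t)
  qed (use p_pos in \<open>auto simp: fun_eq_iff bracket_pow_eq_0\<close>)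
  have ad_\<sigma>: "bracket (snd (\<sigma> x)) = bracket x ^^ ?p" for x
    using ad_F[OF supp(2), of x x] by (simp add: \<sigma>_def[symmetric] fst_\<sigma>)
  have "restricted_lie_algebra scale bracket (\<lambda>x. snd (\<sigma> x))"
    by (simp add: restricted_lie_algebra_iff ad_\<sigma> \<sigma>_scale m_def \<sigma>_add twisted_add_def fst_\<sigma>)
  moreover have "snd (\<sigma> b) = y b" if "b \<in> B" for b
  proof -
    have "r b = (\<lambda>v. if v = b then 1 else 0)"
      using representation_basis[OF indep that] by (simp add: r_def)
    then have "{v. r b v \<noteq> 0} = {b}" "r b b = 1" by auto
    then show ?thesis by (simp add: \<sigma>_def t_def twisted_add_def)
  qed
  ultimately show "\<exists>pmap. restricted_lie_algebra scale bracket pmap \<and> (\<forall>b\<in>B. pmap b = y b)"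
    by blast
next
  fix f g
  assume f: "restricted_lie_algebra scale bracket f \<and> (\<forall>b\<in>B. f b = y b)"
    and g: "restricted_lie_algebra scale bracket g \<and> (\<forall>b\<in>B. g b = y b)"
  \<comment> \<open>Semilinearity with the scalar 0, where 0^p = 0.\<close>
  have zero: "h 0 = 0" if "restricted_lie_algebra scale bracket h" for h
    using that CHAR_gt_1 unfolding restricted_lie_algebra_iff
    by (metis power_0_left less_nat_zero_code scale_zero_left)
  show "f = g"
  proof
    fix x
    have "x \<in> span B" using span by simp
    then show "f x = g x"
    proof (induction rule: span_induct_alt)
      case base
      then show ?case by (metis f g zero)
    next
      case (step c b z)
      \<comment> \<open>Both maps have the same additivity defect, so their values at c b + z follow
        from those at b and z by one formula.\<close>
      then show ?case using f g by (simp add: restricted_lie_algebra_iff)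
    qed
  qed
qed

end

section \<open>The Virasoro algebra\<close>

lemma lookup_vir_scale [simp]:
  "Poly_Mapping.lookup (vir_scale l x) i = l * Poly_Mapping.lookup x i"
  by (simp add: vir_scale_def Poly_Mapping.map.rep_eq when_def)

lemma vector_space_vir_scale: "vector_space vir_scale"
  by unfold_locales (auto intro!: poly_mapping_eqI simp: lookup_add algebra_simps)

interpretation vir: vector_space vir_scale
  by (rule vector_space_vir_scale)

lemma vir_scale_single: "vir_scale l (Poly_Mapping.single i c) = Poly_Mapping.single i (l * c)"
  by (rule poly_mapping_eqI) (simp add: lookup_single when_def)

lemma vir_induct [case_names L c add]:
  assumes "\<And>a m. R (vir_scale a (vir_L m))" "\<And>a. R (vir_scale a vir_c)"
    "\<And>x y. R x \<Longrightarrow> R y \<Longrightarrow> R (x + y)"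
  shows "R x"
proof (induction x rule: Poly_Mapping.update_induct)
  case const
  show ?case using assms(2)[of 0] by simp
next
  case (update f i b)
  have "Poly_Mapping.update i b f = f + Poly_Mapping.single i b"
    using update(1)
    by (intro poly_mapping_eqI)
      (auto simp: lookup_update lookup_add lookup_single when_def in_keys_iff)
  moreover have "R (Poly_Mapping.single i b)"
    using assms(1)[of b] assms(2)[of b]
    by (cases i) (simp_all add: vir_L_def vir_c_def vir_scale_single)
  ultimately show ?case using update(3) assms(3) by simp
qed

section \<open>Bilinearity and the Lie algebra axioms for the Virasoro bracket\<close>

lemma vir_bracket_eq:
  assumes "finite A" "finite B" "Poly_Mapping.keys x \<subseteq> A" "Poly_Mapping.keys y \<subseteq> B"
  shows "vir_bracket x y = (\<Sum>i\<in>A. \<Sum>j\<in>B.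
    vir_scale (Poly_Mapping.lookup x i * Poly_Mapping.lookup y j) (vir_basis_bracket i j))"
proof -
  have "vir_bracket x y = (\<Sum>i\<in>Poly_Mapping.keys x. \<Sum>j\<in>B.
    vir_scale (Poly_Mapping.lookup x i * Poly_Mapping.lookup y j) (vir_basis_bracket i j))"
    unfolding vir_bracket_def using assms
    by (intro sum.cong refl sum.mono_neutral_left) (auto simp: in_keys_iff)
  also have "\<dots> = (\<Sum>i\<in>A. \<Sum>j\<in>B.
    vir_scale (Poly_Mapping.lookup x i * Poly_Mapping.lookup y j) (vir_basis_bracket i j))"
    using assms by (intro sum.mono_neutral_left) (auto simp: in_keys_iff)
  finally show ?thesis .
qed

lemma vir_bracket_add_left: "vir_bracket (x + y) z = vir_bracket x z + vir_bracket y z"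
proof -
  let ?A = "Poly_Mapping.keys x \<union> Poly_Mapping.keys y"
  show ?thesis
    using Poly_Mapping.keys_add[of x y]
    by (subst (1 2 3) vir_bracket_eq[of ?A "Poly_Mapping.keys z"])
      (auto simp: lookup_add distrib_right vir.scale_left_distrib sum.distrib)
qed

lemma vir_bracket_add_right: "vir_bracket x (y + z) = vir_bracket x y + vir_bracket x z"
proof -
  let ?A = "Poly_Mapping.keys y \<union> Poly_Mapping.keys z"
  show ?thesis
    using Poly_Mapping.keys_add[of y z]
    by (subst (1 2 3) vir_bracket_eq[of "Poly_Mapping.keys x" ?A])
      (auto simp: lookup_add distrib_left vir.scale_left_distrib sum.distrib)
qed

lemma keys_vir_scale: "Poly_Mapping.keys (vir_scale l x) \<subseteq> Poly_Mapping.keys x"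
  by (auto simp: in_keys_iff)

lemma vir_bracket_scale_left: "vir_bracket (vir_scale l x) y = vir_scale l (vir_bracket x y)"
  by (subst (1 2) vir_bracket_eq[of "Poly_Mapping.keys x" "Poly_Mapping.keys y"])
    (use keys_vir_scale in \<open>auto simp: vir.scale_sum_right mult.assoc\<close>)

lemma vir_bracket_scale_right: "vir_bracket x (vir_scale l y) = vir_scale l (vir_bracket x y)"
  by (subst (1 2) vir_bracket_eq[of "Poly_Mapping.keys x" "Poly_Mapping.keys y"])
    (use keys_vir_scale in \<open>auto simp: vir.scale_sum_right mult.left_commute\<close>)

lemma vir_bracket_zero: "vir_bracket 0 x = 0" "vir_bracket x 0 = 0"
  by (simp_all add: vir_bracket_def)

lemmas vir_bracket_simps = vir_bracket_zero vir_bracket_add_left vir_bracket_add_right vir_bracket_scale_left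
  vir_bracket_scale_right vir_bracket_c

text \<open>The factor 6 is cancelled in the integers, since it is 0 in a field of characteristic
  3.\<close>

lemma binom_Suc_3_minus: "binom_Suc_3 (- m) = - binom_Suc_3 m"
proof -
  have "6 * binom_Suc_3 (- m) = 6 * (- binom_Suc_3 m)"
    unfolding mult_minus_right binom_Suc_3 by (simp add: algebra_simps)
  then show ?thesis by simp
qed

lemma vir_bracket_L_L_antisym:
  "vir_bracket (vir_L m) (vir_L n) = - (vir_bracket (vir_L n) (vir_L m) :: 'f::field vir)"
proof -
  have d: "of_int (m - n) = (- of_int (n - m) :: 'f)" by simp
  have b: "1 / 2 * of_int (binom_Suc_3 m) = (- (1 / 2 * of_int (binom_Suc_3 n)) :: 'f)"
    if "m + n = 0"
  proof -
    have "m = - n" using that by simp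
    then show ?thesis by (simp add: binom_Suc_3_minus)
  qed
  show ?thesis
    unfolding vir_bracket_L_L add.commute[of n m] d
    by (cases "m + n = 0")
      (simp_all only: b if_True if_False vir.scale_minus_left minus_add_distrib minus_zero simp_thms)
qed

lemma vir_bracket_antisym: "vir_bracket x y = - vir_bracket y x"
proof (induction x rule: vir_induct)
  case (L a m)
  have "vir_bracket (vir_L m) y = - vir_bracket y (vir_L m)"
    by (induction y rule: vir_induct) (simp_all add: vir_bracket_simps vir_bracket_L_L_antisym[of m])
  then show ?case by (simp add: vir_bracket_simps)
qed (simp_all add: vir_bracket_simps)

lemma vir_bracket_self: "vir_bracket x x = 0"
proof (induction x rule: vir_induct)
  case (L a m)
  \<comment> \<open>A central term arises only for m = 0, where the binomial is 0.\<close>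
  then show ?case
    by (auto simp: vir_bracket_simps vir_bracket_L_L binom_Suc_3_def)
next
  case (add x y)
  then show ?case
    using vir_bracket_antisym[of x y] by (simp add: vir_bracket_simps)
qed (simp add: vir_bracket_simps)

text \<open>This is the central part of the Jacobi identity. Six times it is a polynomial identity
  once k = - m - n, and 6 cancels in the integers.\<close>

lemma binom_Suc_3_cocycle:
  assumes "m + n + k = 0"
  shows "(n - k) * binom_Suc_3 m + (k - m) * binom_Suc_3 n + (m - n) * binom_Suc_3 k = 0"
proof -
  have "6 * ((n - k) * binom_Suc_3 m + (k - m) * binom_Suc_3 n + (m - n) * binom_Suc_3 k) =
    (n - k) * (6 * binom_Suc_3 m) + (k - m) * (6 * binom_Suc_3 n) + (m - n) * (6 * binom_Suc_3 k)"
    by (simp add: algebra_simps)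
  also have "\<dots> = 0"
  proof -
    have k: "k = - m - n" using assms by simp
    show ?thesis unfolding binom_Suc_3 k by algebra
  qed
  finally show ?thesis by simp
qed

text \<open>The central term of the inner bracket is killed by the outer one, so only the outer
  bracket contributes to c.\<close>

lemma vir_bracket_L_L_L:
  "vir_bracket (vir_L m) (vir_bracket (vir_L n) (vir_L k)) =
    vir_scale (of_int ((n - k) * (m - n - k))) (vir_L (m + n + k)) +
    (if m + n + k = 0 then vir_scale (1 / 2 * of_int ((n - k) * binom_Suc_3 m)) vir_c else 0)"
  by (auto simp: vir_bracket_L_L vir_bracket_simps vir.scale_right_distrib add.assoc
      diff_diff_eq mult.left_commute simp del: of_int_diff)

lemma vir_jacobi_L:
  "vir_bracket (vir_L m) (vir_bracket (vir_L n) (vir_L k)) +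
   vir_bracket (vir_L n) (vir_bracket (vir_L k) (vir_L m)) +
   vir_bracket (vir_L k) (vir_bracket (vir_L m) (vir_L n)) = (0 :: 'f::field vir)"
proof -
  have s: "n + k + m = m + n + k" "k + m + n = m + n + k" by simp_all
  have L: "(n - k) * (m - n - k) + (k - m) * (n - k - m) + (m - n) * (k - m - n) = 0"
    by algebra
  have "vir_scale (of_int ((n - k) * (m - n - k))) (vir_L (m + n + k)) +
      vir_scale (of_int ((k - m) * (n - k - m))) (vir_L (m + n + k)) +
      vir_scale (of_int ((m - n) * (k - m - n))) (vir_L (m + n + k)) = (0 :: 'f vir)"
    by (simp only: vir.scale_left_distrib[symmetric] of_int_add[symmetric] L of_int_0
        vir.scale_zero_left)
  moreover have "vir_scale (1 / 2 * of_int ((n - k) * binom_Suc_3 m)) vir_c +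
      vir_scale (1 / 2 * of_int ((k - m) * binom_Suc_3 n)) vir_c +
      vir_scale (1 / 2 * of_int ((m - n) * binom_Suc_3 k)) vir_c = (0 :: 'f vir)"
    if "m + n + k = 0"
    by (simp only: vir.scale_left_distrib[symmetric] of_int_add[symmetric]
        distrib_left[symmetric] binom_Suc_3_cocycle[OF that] of_int_0 mult_zero_right
        vir.scale_zero_left)
  ultimately show ?thesis
    unfolding vir_bracket_L_L_L s by (cases "m + n + k = 0") (simp_all only: if_True if_False add_0_right add_ac simp_thms)
qed

lemma vir_jacobi:
  "vir_bracket x (vir_bracket y z) + vir_bracket y (vir_bracket z x) +
    vir_bracket z (vir_bracket x y) = 0"
proof -
  define J where "J x y z = vir_bracket x (vir_bracket y z) + vir_bracket y (vir_bracket z x) +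
    vir_bracket z (vir_bracket x y)" for x y z :: "'a vir"
  have add: "J (x + x') y z = J x y z + J x' y z" "J x (y + y') z = J x y z + J x y' z"
    "J x y (z + z') = J x y z + J x y z'" for x x' y y' z z'
    unfolding J_def by (simp_all add: vir_bracket_simps ac_simps)
  have scale: "J (vir_scale l x) y z = vir_scale l (J x y z)"
    "J x (vir_scale l y) z = vir_scale l (J x y z)"
    "J x y (vir_scale l z) = vir_scale l (J x y z)" for l x y z
    unfolding J_def by (simp_all add: vir_bracket_simps vir.scale_right_distrib)
  have c: "J vir_c y z = 0" "J x vir_c z = 0" "J x y vir_c = 0" for x y z
    unfolding J_def by (simp_all add: vir_bracket_simps)
  have "J (vir_L m) (vir_L n) (vir_L k) = 0" for m n k
    unfolding J_def by (rule vir_jacobi_L)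
  then have "J (vir_L m) (vir_L n) z = 0" for m n
    by (induction z rule: vir_induct) (simp_all add: add scale c)
  then have "J (vir_L m) y z = 0" for m
    by (induction y rule: vir_induct) (simp_all add: add scale c)
  then have "J x y z = 0"
    by (induction x rule: vir_induct) (simp_all add: add scale c)
  then show ?thesis by (simp add: J_def)
qed

lemma lie_algebra_vir: "lie_algebra vir_scale vir_bracket"
  by (simp add: lie_algebra_def lie_algebra_axioms_def Vector_Spaces.linear_iff
      vector_space_vir_scale vir_bracket_simps vir_bracket_self vir_jacobi)

section \<open>The basis of the Virasoro algebra\<close>

definition vir_basis :: "vir_index \<Rightarrow> 'f::field vir" where
  "vir_basis i = Poly_Mapping.single i 1"

lemma vir_basis_simps [simp]: "vir_basis (L_index m) = vir_L m" "vir_basis C_index = vir_c"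
  by (simp_all add: vir_basis_def vir_L_def vir_c_def)

lemma inj_vir_basis: "inj vir_basis"
  by (rule injI) (metis vir_basis_def lookup_single_eq lookup_single_not_eq zero_neq_one)

lemma independent_vir_basis: "vir.independent (range vir_basis)"
  unfolding vir.dependent_def
proof safe
  fix i
  assume "vir_basis i \<in> vir.span (range vir_basis - {vir_basis i :: 'a vir})"
  \<comment> \<open>The i-th coordinate functional vanishes on the span of the other basis
    vectors.\<close>
  then have "Poly_Mapping.lookup (vir_basis i :: 'a vir) i = 0"
  proof (induction rule: vir.span_induct)
    case base
    show ?case by (auto simp: vir.subspace_def lookup_add)
  next
    case (step x)
    then show ?case by (auto simp: vir_basis_def lookup_single when_def)
  qed
  then show False by (simp add: vir_basis_def)
qed

lemma span_vir_basis: "vir.span (range vir_basis) = UNIV"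
proof -
  have "x \<in> vir.span (range vir_basis)" for x :: "'a vir"
  proof (induction x rule: vir_induct)
    case (L a m)
    show ?case
      unfolding vir_L_def vir_basis_def by (intro vir.span_scale vir.span_base rangeI)
  next
    case (c a)
    show ?case
      unfolding vir_c_def vir_basis_def by (intro vir.span_scale vir.span_base rangeI)
  qed (rule vir.span_add)
  then show ?thesis by auto
qed

text \<open>The last bracket is left unevaluated: earlier central terms are killed by the next
  bracket, so c can appear only there.\<close>

lemma vir_bracket_L_pow_Suc:
  "(vir_bracket (vir_L m) ^^ Suc k) (vir_L n :: 'f::field vir) =
    vir_scale (\<Prod>i<k. of_int (m - n - int i * m)) (vir_bracket (vir_L m) (vir_L (n + int k * m)))"
proof (induction k)
  case (Suc k)
  have "(vir_bracket (vir_L m) ^^ Suc (Suc k)) (vir_L n :: 'f vir) =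
      vir_scale (\<Prod>i<k. of_int (m - n - int i * m))
        (vir_bracket (vir_L m) (vir_bracket (vir_L m) (vir_L (n + int k * m))))"
    by (simp only: funpow.simps(2)[of "Suc k"] comp_apply Suc.IH vir_bracket_scale_right)
  also have "vir_bracket (vir_L m) (vir_bracket (vir_L m) (vir_L (n + int k * m))) =
      vir_scale (of_int (m - n - int k * m))
        (vir_bracket (vir_L m) (vir_L (n + int (Suc k) * m)) :: 'f vir)"
  proof -
    have e: "m + (n + int k * m) = n + int (Suc k) * m" "m - (n + int k * m) = m - n - int k * m"
      by (simp_all add: algebra_simps)
    show ?thesis
      unfolding vir_bracket_L_L[of m "n + int k * m"] e
      by (simp add: vir_bracket_simps del: of_int_diff of_nat_Suc)
  qed
  finally show ?case by (simp add: mult.commute)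
qed simp

section \<open>Arithmetic modulo p and the p-th power of ad L_m\<close>

lemma of_int_power_CHAR:
  assumes "prime CHAR('f::field)" "odd CHAR('f)"
  shows "(of_int x :: 'f) ^ CHAR('f) = of_int x"
proof -
  \<comment> \<open>Fermat's little theorem by induction on n, expanding (1 + n)^p; odd p then takes
    care of negative integers.\<close>
  have "(of_nat n :: 'f) ^ CHAR('f) = of_nat n" for n
    using freshmans_dream[OF assms(1) refl, of 1 "of_nat _"] assms(1)
    by (induction n) (simp_all add: prime_gt_0_nat)
  then show ?thesis
    using assms(2) by (cases x rule: int_cases2) simp_all
qed

lemma ex_dvd_diff_mult:
  fixes m n :: int
  assumes "prime p" "\<not> int p dvd m"
  shows "\<exists>i<p. int p dvd m - n - int i * m"
proof -
  have "coprime m (int p)"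
    using assms by (metis coprime_commute prime_imp_coprime prime_nat_int_transfer)
  then obtain u v where uv: "u * m + v * int p = 1"
    by (metis bezout_int coprime_imp_gcd_eq_1)
  \<comment> \<open>u inverts m modulo p, so i is the residue solving i m = m - n modulo p.\<close>
  define i where "i = nat (((m - n) * u) mod int p)"
  have p: "int p > 0" using assms(1) by (simp add: prime_gt_0_nat)
  have "int i = ((m - n) * u) mod int p" using p by (simp add: i_def)
  then have i: "int i = (m - n) * u - int p * (((m - n) * u) div int p)"
    by (simp add: minus_mult_div_eq_mod)
  have "m - n = (m - n) * (u * m + v * int p)" using uv by simp
  then have "m - n - int i * m = int p * ((m - n) * v + ((m - n) * u) div int p * m)"
    unfolding i by (simp add: algebra_simps)
  moreover have "i < p" using p by (simp add: i_def nat_less_iff)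
  ultimately show ?thesis by auto
qed

text \<open>As p divides m, p^2 divides p m and hence six times the binomial. For p > 3 the 6 is
  prime to p; for p = 3 it absorbs only one of the two factors 3.\<close>

lemma dvd_binom_Suc_3:
  assumes "prime p" "p \<ge> 3" "int p dvd m"
  shows "int p dvd binom_Suc_3 (int p * m)"
proof -
  have "int p * int p dvd 6 * binom_Suc_3 (int p * m)"
    unfolding binom_Suc_3 using assms(3) by (auto simp: mult_dvd_mono intro!: dvd_mult dvd_mult2)
  then show ?thesis
  proof (cases "p = 3")
    case True
    assume "int p * int p dvd 6 * binom_Suc_3 (int p * m)"
    with True show ?thesis by simp presburger
  next
    case False
    assume *: "int p * int p dvd 6 * binom_Suc_3 (int p * m)"
    have "\<not> p dvd 6"
    proof
      assume "p dvd 6"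
      then have "p dvd 2 * 3" by simp
      then have "p dvd 2 \<or> p dvd 3" using assms(1) by (simp only: prime_dvd_mult_iff)
      then show False using False assms(2) by (auto dest!: dvd_imp_le)
    qed
    then have "\<not> int p dvd 6" by (metis int_dvd_int_iff of_nat_numeral)
    moreover have "int p dvd 6 * binom_Suc_3 (int p * m)" using * dvd_mult_left by blast
    ultimately show ?thesis
      using assms(1) by (metis prime_dvd_mult_iff prime_nat_int_transfer)
  qed
qed

lemma vir_bracket_L_pow_CHAR:
  assumes p: "prime CHAR('f::field)" "CHAR('f) \<ge> 3"
  shows "(vir_bracket (vir_L m) ^^ CHAR('f)) (vir_L n :: 'f vir) =
    vir_bracket (if int CHAR('f) dvd m then vir_L (int CHAR('f) * m) else 0) (vir_L n)"
proof -
  define p where "p = CHAR('f)"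
  \<comment> \<open>The first p - 1 factors. The L-term acquires one more, at i = p - 1, while the
    central term has only these.\<close>
  define P where "P = (\<Prod>i<p - 1. of_int (m - n - int i * m) :: 'f)"
  have p1: "Suc (p - 1) = p" "int (p - 1) = int p - 1" using p by (auto simp: p_def)
  have odd: "odd p" using p prime_odd_nat by (auto simp: p_def)
  have zero: "of_int x = (0 :: 'f) \<longleftrightarrow> int p dvd x" for x
    by (simp add: of_int_eq_0_iff_char_dvd p_def)
  have "(vir_bracket (vir_L m) ^^ p) (vir_L n :: 'f vir) =
      vir_scale P (vir_bracket (vir_L m) (vir_L (n + int (p - 1) * m)))"
    unfolding P_def by (subst (1) p1(1)[symmetric]) (rule vir_bracket_L_pow_Suc)
  also have "\<dots> = vir_scale (P * of_int (m - n - int (p - 1) * m)) (vir_L (n + int p * m)) +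
      (if n + int p * m = 0 then vir_scale (P * (1 / 2 * of_int (binom_Suc_3 m))) vir_c else 0)"
  proof -
    have e: "m + (n + int (p - 1) * m) = n + int p * m" "m - (n + int (p - 1) * m) = m - n - int (p - 1) * m"
      unfolding p1(2) by (simp_all add: algebra_simps)
    show ?thesis
      unfolding vir_bracket_L_L e by (simp add: vir.scale_right_distrib del: of_int_diff)
  qed
  finally have lhs: "(vir_bracket (vir_L m) ^^ p) (vir_L n :: 'f vir) = \<dots>" .
  show ?thesis
  proof (cases "int p dvd m")
    case True
    then have m: "of_int m = (0 :: 'f)" by (simp add: zero)
    have P: "P = (- of_int n) ^ (p - 1)" by (simp add: P_def m)
    have "P * of_int (m - n - int (p - 1) * m) = (- of_int n) ^ Suc (p - 1)"
      by (simp add: P m)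
    also have "\<dots> = - of_int n"
      using of_int_power_CHAR[of "- n", where 'f = 'f] p odd by (simp add: p1 p_def)
    \<comment> \<open>This is the coefficient in the bracket of L_(pm) with L_n.\<close>
    also have "\<dots> = of_int (int p * m - n)" by (simp add: m)
    finally have 1: "P * of_int (m - n - int (p - 1) * m) = of_int (int p * m - n)" .
    \<comment> \<open>A central term needs n = - p m; then n = 0 in the field and so is every factor
      of P.\<close>
    have "P = 0" if "n + int p * m = 0"
    proof -
      have "n = int p * - m" using that by simp
      then have "of_int n = (0 :: 'f)" unfolding zero by (metis dvd_triv_left)
      then show ?thesis using p by (simp add: P p_def)
    qed
    \<comment> \<open>The central term of the bracket of L_(pm) with L_n vanishes too.\<close>
    moreover have "of_int (binom_Suc_3 (int p * m)) = (0 :: 'f)"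
      unfolding zero using p True by (intro dvd_binom_Suc_3) (auto simp: p_def)
    ultimately show ?thesis
      using True lhs unfolding p_def[symmetric] 1 by (auto simp: vir_bracket_L_L add.commute)
  next
    case False
    then obtain i where i: "i < p" "int p dvd m - n - int i * m"
      using ex_dvd_diff_mult[of p m n] p by (auto simp: p_def)
    have P0: "P = 0" if "j < p - 1" "int p dvd m - n - int j * m" for j
      unfolding P_def using that by (intro prod_zero bexI[of _ j]) (simp_all only: zero finite_lessThan lessThan_iff)
    \<comment> \<open>The vanishing factor lies in P or is the last one, i = p - 1.\<close>
    have "P * of_int (m - n - int (p - 1) * m) = 0"
      using i P0[of i] zero[of "m - n - int (p - 1) * m"] by (cases "i = p - 1") auto
    \<comment> \<open>For n = - p m the factor at i = 1 is p m; it occurs in P because p >= 3 gives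
      1 < p - 1.\<close>
    moreover have "P = 0" if "n + int p * m = 0"
    proof (rule P0[of 1])
      show "1 < p - 1" using p by (simp add: p_def)
      have "m - n - int 1 * m = int p * m" using that by simp
      then show "int p dvd m - n - int 1 * m" by simp
    qed
    ultimately show ?thesis
      using False lhs unfolding p_def[symmetric] by (auto simp: vir_bracket_zero)
  qed
qed

theorem lemma3p8:
  fixes p :: nat
  assumes "prime p" and "p \<ge> 3" and "CHAR('f::alg_closed_field) = p"
  shows "\<exists>!pmap :: 'f vir \<Rightarrow> 'f vir.
           restricted_lie_algebra vir_scale vir_bracket pmap \<and>
           pmap vir_c = vir_c \<and>
           (\<forall>m. pmap (vir_L m) = (if int p dvd m then vir_L (int p * m) else 0))"
proof -
  interpret lie_algebra_prime_char "vir_scale :: 'f \<Rightarrow> _" vir_bracket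
    using assms
    by (intro lie_algebra_prime_char.intro lie_algebra_prime_char_axioms.intro lie_algebra_vir) simp
  have L_pow: "vir_bracket (if int p dvd m then vir_L (int p * m) else 0) =
      vir_bracket (vir_L m :: 'f vir) ^^ p" (is "vir_bracket ?y = _") for m
  proof
    fix x :: "'f vir"
    show "vir_bracket ?y x = (vir_bracket (vir_L m) ^^ p) x"
    proof (induction x rule: vir_induct)
      case (L a n)
      show ?case
        using vir_bracket_L_pow_CHAR[where 'f = 'f, of m n] assms
        by (simp add: bracket_pow_scale bracket_scale_right)
    next
      case (c a)
      show ?case
        using assms by (simp add: bracket_pow_scale bracket_scale_right bracket_pow_eq_0 vir_bracket_c)
    next
      case (add x y)
      then show ?case by (simp add: bracket_pow_add bracket_add_right)
    qed
  qed
  define z :: "vir_index \<Rightarrow> 'f vir" where "z i = (case i of C_index \<Rightarrow> vir_c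
    | L_index m \<Rightarrow> if int p dvd m then vir_L (int p * m) else 0)" for i
  \<comment> \<open>\<open>ex1_restricted_lie_algebra\<close> prescribes images on basis vectors, so
    the index-wise prescription \<open>z\<close> is transported along the injective
    \<open>vir_basis\<close>.\<close>
  define y where "y b = z (inv vir_basis b)" for b :: "'f vir"
  have y_basis: "y (vir_basis i) = z i" for i
    by (simp add: y_def inj_vir_basis)
  \<comment> \<open>Both sides are the zero map. Any central image of c would pass this test, so the
    value c is a genuine prescription.\<close>
  have c_pow: "vir_bracket (vir_c :: 'f vir) = vir_bracket vir_c ^^ p"
    using assms by (auto simp: fun_eq_iff vir_bracket_c bracket_pow_eq_0)
  have "vir_bracket (y b) = vir_bracket b ^^ CHAR('f)" if "b \<in> range vir_basis" for b
  proof -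
    from that obtain i where b: "b = vir_basis i" by blast
    show ?thesis
    proof (cases i)
      case (L_index m)
      with L_pow[of m] show ?thesis
        unfolding b y_basis by (simp add: z_def assms)
    next
      case C_index
      with c_pow show ?thesis
        unfolding b y_basis by (simp add: z_def assms)
    qed
  qed
  from ex1_restricted_lie_algebra[OF independent_vir_basis span_vir_basis this]
  have "\<exists>!pmap. restricted_lie_algebra vir_scale vir_bracket pmap \<and>
      (\<forall>b\<in>range vir_basis. pmap b = y b)" .
  moreover have "(\<forall>b\<in>range vir_basis. f b = y b) \<longleftrightarrow> f vir_c = vir_c \<and>
      (\<forall>m. f (vir_L m) = (if int p dvd m then vir_L (int p * m) else 0))" for f :: "'f vir \<Rightarrow> 'f vir"
  proof -
    have "(\<forall>b\<in>range vir_basis. f b = y b) \<longleftrightarrow> (\<forall>i. f (vir_basis i) = z i)"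
      by (auto simp: y_basis)
    also have "\<dots> \<longleftrightarrow> f (vir_basis C_index) = z C_index \<and>
        (\<forall>m. f (vir_basis (L_index m)) = z (L_index m))"
      by (metis vir_index.exhaust)
    finally show ?thesis by (simp add: z_def)
  qed
  ultimately show ?thesis by simp
qed

end
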